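(* Let $A\in\mathbb{R}^{p\times m}$, $B\in\mathbb{R}^{n\times q}$, let $G\in\mathbb{R}^{m\times m}$ be symmetric positive definite, and let $S\in\mathbb{R}^{p\times\tau_1}$, $P\in\mathbb{R}^{q\times\tau_2}$ be random matrices. The quantity $\rho=1-\lambda_{\min}\left(\mathbf{E}[Z_2\otimes Z_1']\right)$ satisfies $$0\le 1-\frac{\mathbf{E}[d]}{mn}\le\rho\le 1,$$ where $d=\mathrm{rank}\left((P^\top B^\top)\otimes(S^\top A)\right)$.
   Context: $\tau_1,\tau_2$ may be random. With $\dagger$ the Moore-Penrose pseudoinverse, $$Z_1'=G^{-1}A^\top S\,(S^\top AG^{-1}A^\top S)^\dagger S^\top A\in\mathbb{R}^{m\times m},\qquad Z_2=BP\,(P^\top B^\top BP)^\dagger P^\top B^\top\in\mathbb{R}^{n\times n}.$$ $\otimes$ is the Kronecker product; $\lambda_{\min}$ is the smallest eigenvalue ($\mathbf{E}[Z_2\otimes Z_1']$ is similar to a symmetric matrix via conjugation by $I\otimes G^{1/2}$, so its eigenvalues are real). The rank $d$ is a random variable. *)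

theory Defs
  imports
    "HOL-Probability.Probability"
    "Jordan_Normal_Form.Spectral_Radius"
    "Jordan_Normal_Form.Gauss_Jordan_Elimination"
    "Jordan_Normal_Form.DL_Rank"
begin

(* The numbers of columns of S and P may be random, so matrices are those of
   Jordan_Normal_Form, whose dimensions are part of the value. *)

definition sym_pos_def :: "nat \<Rightarrow> real mat \<Rightarrow> bool" where
  "sym_pos_def m G \<longleftrightarrow>
     G \<in> carrier_mat m m \<and> transpose_mat G = G \<and>
     (\<forall>v \<in> carrier_vec m. v \<noteq> 0\<^sub>v m \<longrightarrow> scalar_prod v (G *\<^sub>v v) > 0)"

definition kron :: "real mat \<Rightarrow> real mat \<Rightarrow> real mat" where
  "kron X Y = mat (dim_row X * dim_row Y) (dim_col X * dim_col Y)
     (\<lambda>(i, j). X $$ (i div dim_row Y, j div dim_col Y) * Y $$ (i mod dim_row Y, j mod dim_col Y))"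

(* The four Penrose equations; every real matrix X has exactly one solution Y. *)
definition is_pinv :: "real mat \<Rightarrow> real mat \<Rightarrow> bool" where
  "is_pinv X Y \<longleftrightarrow>
     Y \<in> carrier_mat (dim_col X) (dim_row X) \<and>
     X * Y * X = X \<and> Y * X * Y = Y \<and>
     transpose_mat (X * Y) = X * Y \<and> transpose_mat (Y * X) = Y * X"

definition pinv :: "real mat \<Rightarrow> real mat" where
  "pinv X = (THE Y. is_pinv X Y)"

(* Z1 stands for the nonsymmetric matrix $Z_1'$; mat_inverse is option-valued
   and yields Some for the invertible G considered here. *)
definition Z1 :: "real mat \<Rightarrow> real mat \<Rightarrow> real mat \<Rightarrow> real mat" where
  "Z1 A G S =
     (let Gi = the (mat_inverse G); At = transpose_mat A; St = transpose_mat S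
      in Gi * At * S * pinv (St * A * Gi * At * S) * St * A)"

definition Z2 :: "real mat \<Rightarrow> real mat \<Rightarrow> real mat" where
  "Z2 B P =
     (let Bt = transpose_mat B; Pt = transpose_mat P
      in B * P * pinv (Pt * Bt * B * P) * Pt * Bt)"

(* In vec_space.rank the explicit argument is the number of rows. *)
definition mat_rank :: "real mat \<Rightarrow> nat" where
  "mat_rank X = vec_space.rank (dim_row X) X"

(* The smallest real eigenvalue.  It is the smallest eigenvalue when all
   eigenvalues are real, as for matrices similar to a symmetric one. *)
definition lambda_min :: "real mat \<Rightarrow> real" where
  "lambda_min X = Min (spectrum X)"

(* A random matrix with r rows and a possibly random number t of columns.
   Entries beyond the current number of columns are unspecified, so they are
   replaced by 0 before asking for measurability. *)
definition random_mat ::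
  "'w measure \<Rightarrow> nat \<Rightarrow> ('w \<Rightarrow> nat) \<Rightarrow> ('w \<Rightarrow> real mat) \<Rightarrow> bool" where
  "random_mat M r t X \<longleftrightarrow>
     t \<in> measurable M (count_space UNIV) \<and>
     (\<forall>w \<in> space M. X w \<in> carrier_mat r (t w)) \<and>
     (\<forall>i < r. \<forall>j. (\<lambda>w. if j < t w then X w $$ (i, j) else 0) \<in> borel_measurable M)"

definition expect_mat ::
  "'w measure \<Rightarrow> nat \<Rightarrow> nat \<Rightarrow> ('w \<Rightarrow> real mat) \<Rightarrow> real mat" where
  "expect_mat M r c X = mat r c (\<lambda>(i, j). integral\<^sup>L M (\<lambda>w. X w $$ (i, j)))"

end

theory Submission
  imports Defs
begin

text \<open>
  For a positive definite \<open>G\<close>, call \<open>Q\<close> the \<open>G\<close>-orthogonal projection of \<open>Y\<close> if \<open>Y Q = Y\<close>,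
  \<open>Q = L Y\<close> for some \<open>L\<close>, and \<open>G Q\<close> is symmetric.  Such a \<open>Q\<close> is unique, and \<open>Z\<^sub>1'\<close>, \<open>Z\<^sub>2\<close> and
  \<open>Z = Z\<^sub>2 \<otimes> Z\<^sub>1'\<close> are the projections of \<open>S\<^sup>T A\<close>, \<open>P\<^sup>T B\<^sup>T\<close> and their Kronecker product.  Hence \<open>Z\<close>
  is idempotent with trace \<open>d\<close>, and \<open>0 \<le> (I \<otimes> G) Z \<le> I \<otimes> G\<close>.  Uniqueness also identifies the projection
  with the outcome of the Gram-Schmidt process, which depends measurably on the rows of \<open>Y\<close>, so that \<open>Z\<close> is
  measurable and bounded.  Therefore \<open>(I \<otimes> G) E[Z]\<close> is symmetric and positive semidefinite, all eigenvalues of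
  \<open>E[Z]\<close> are real and nonnegative, and their sum is \<open>tr E[Z] = E[d]\<close>, which is at least \<open>m n\<close> times the
  smallest one.
\<close>

unbundle no vec_syntax

section \<open>Orthogonal projections and the Gram-Schmidt process\<close>

lemma sym_pos_def_one: "sym_pos_def n (1\<^sub>m n)"
proof -
  have "scalar_prod v v > 0" if v: "v \<in> carrier_vec n" "v \<noteq> 0\<^sub>v n" for v :: "real vec"
  proof -
    have "\<exists>i<n. v $ i \<noteq> 0" using v by (metis carrier_vecD eq_vecI index_zero_vec)
    then obtain i where i: "i < n" "v $ i \<noteq> 0" by blast
    have "0 < v $ i * v $ i" using i by (auto simp: zero_less_mult_iff linorder_neq_iff)
    also have "\<dots> \<le> (\<Sum>i\<in>{0..<n}. v $ i * v $ i)"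
      by (rule member_le_sum[of i "{0..<n}" "\<lambda>i. v $ i * v $ i"]) (use i in auto)
    finally show ?thesis using v by (simp add: scalar_prod_def)
  qed
  then show ?thesis unfolding sym_pos_def_def by auto
qed

text \<open>A kernel vector of \<open>G\<close> would violate positivity, so \<open>det G\<close> is
  nonzero. The form of \<open>Gi\<close> at \<open>v\<close> is the form of \<open>G\<close> at
  \<open>Gi *\<^sub>v v\<close>.\<close>

lemma sym_pos_def_inverse:
  assumes G: "sym_pos_def m G"
  obtains Gi where "mat_inverse G = Some Gi" "G * Gi = 1\<^sub>m m" "Gi * G = 1\<^sub>m m"
    "sym_pos_def m Gi"
proof -
  have Gc: "G \<in> carrier_mat m m" and Gt: "transpose_mat G = G"
    and Gp: "\<And>v. v \<in> carrier_vec m \<Longrightarrow> v \<noteq> 0\<^sub>v m \<Longrightarrow> scalar_prod v (G *\<^sub>v v) > 0"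
    using G by (auto simp: sym_pos_def_def)
  have "det G \<noteq> 0"
  proof
    assume "det G = 0"
    then obtain v where "v \<in> carrier_vec m" "v \<noteq> 0\<^sub>v m" "G *\<^sub>v v = 0\<^sub>v m"
      using det_0_iff_vec_prod_zero_field[OF Gc] by blast
    with Gp[of v] show False by simp
  qed
  then have "G \<in> Units (ring_mat TYPE(real) m ())" by (rule det_non_zero_imp_unit[OF Gc])
  then obtain Gi where Gi: "mat_inverse G = Some Gi" using mat_inverse(1)[OF Gc, of "()"] by (cases "mat_inverse G") auto
  from mat_inverse(2)[OF Gc Gi] have i1: "G * Gi = 1\<^sub>m m" and i2: "Gi * G = 1\<^sub>m m"
    and Gic: "Gi \<in> carrier_mat m m" by auto
  have Git: "transpose_mat Gi = Gi"
  proof -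
    have "transpose_mat Gi * G = 1\<^sub>m m"
      using arg_cong[OF i1, of transpose_mat] Gc Gic Gt by (simp add: transpose_mult[of _ m m _ m])
    then have "transpose_mat Gi * G * Gi = Gi" using Gic by simp
    then show ?thesis using Gc Gic i1 by (simp add: assoc_mult_mat[of _ m m _ m _ m])
  qed
  have "scalar_prod v (Gi *\<^sub>v v) > 0" if v: "v \<in> carrier_vec m" "v \<noteq> 0\<^sub>v m" for v
  proof -
    let ?u = "Gi *\<^sub>v v"
    have u: "?u \<in> carrier_vec m" using Gic v by simp
    have Gu: "G *\<^sub>v ?u = v" using Gc Gic v i1
      by (metis assoc_mult_mat_vec one_mult_mat_vec)
    have "?u \<noteq> 0\<^sub>v m"
    proof
      assume "?u = 0\<^sub>v m"
      with Gu Gc have "v = 0\<^sub>v m" by auto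
      with v show False by simp
    qed
    from Gp[OF u this] Gu have "scalar_prod ?u v > 0" by simp
    then show ?thesis using comm_scalar_prod[OF u v(1)] by simp
  qed
  then have "sym_pos_def m Gi" unfolding sym_pos_def_def using Gic Git by auto
  with that Gi i1 i2 show thesis by blast
qed

text \<open>The diagonal of \<open>X * K * transpose_mat X\<close> holds the values of the form
  \<open>K\<close> at the rows of \<open>X\<close>; definiteness makes each row vanish.\<close>

lemma congruence_eq_0D:
  assumes K: "sym_pos_def m K" and X: "X \<in> carrier_mat r m"
    and z: "X * K * transpose_mat X = 0\<^sub>m r r"
  shows "X = 0\<^sub>m r m"
proof (rule eq_matI)
  fix i j assume ij: "i < dim_row (0\<^sub>m r m)" "j < dim_col (0\<^sub>m r m)"
  have Kc: "K \<in> carrier_mat m m" using K by (simp add: sym_pos_def_def)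
  have rw: "row X i \<in> carrier_vec m" using X by auto
  have "(X * (K * transpose_mat X)) $$ (i,i) = 0"
    using z ij X Kc by (simp add: assoc_mult_mat[of _ r m _ m _ r])
  moreover have "(X * (K * transpose_mat X)) $$ (i,i) = scalar_prod (row X i) (K *\<^sub>v row X i)"
  proof -
    have "K *\<^sub>v row X i = vec m (\<lambda>k. scalar_prod (row K k) (row X i))"
      using Kc by (auto simp: mult_mat_vec_def)
    then show ?thesis using ij X Kc by simp
  qed
  ultimately have "row X i = 0\<^sub>v m"
    using K rw unfolding sym_pos_def_def by (metis less_irrefl)
  then show "X $$ (i,j) = 0\<^sub>m r m $$ (i,j)" using ij X by (metis carrier_matD index_row(1) index_zero_mat index_zero_vec(1))
qed (use X in auto)

text \<open>For positive definite \<open>G\<close> this is the projector along the kernel of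
  \<open>Y\<close> onto its orthogonal complement in the inner product given by \<open>G\<close>.
  Equations in place of subspaces make it easy to combine with transposes, Kronecker products and
  traces.\<close>

definition oproj :: "real mat \<Rightarrow> real mat \<Rightarrow> real mat \<Rightarrow> bool" where
  "oproj G Y Q \<longleftrightarrow>
     Q \<in> carrier_mat (dim_col Y) (dim_col Y) \<and> Y * Q = Y \<and>
     (\<exists>L \<in> carrier_mat (dim_col Y) (dim_row Y). Q = L * Y) \<and>
     transpose_mat (G * Q) = G * Q"

text \<open>Writing \<open>Q = L * Y\<close>, the factor \<open>R\<close> is absorbed by
  \<open>Y * R = Y\<close>. The case \<open>R = Q\<close> is idempotence.\<close>

lemma oproj_absorb:
  assumes "oproj G Y Q" "oproj G' Y R"
  shows "Q * R = Q"
proof -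
  from assms obtain L where "L \<in> carrier_mat (dim_col Y) (dim_row Y)" "Q = L * Y" "Y * R = Y"
    "R \<in> carrier_mat (dim_col Y) (dim_col Y)"
    by (auto simp: oproj_def)
  then show ?thesis
    by (simp add: assoc_mult_mat[of _ "dim_col Y" "dim_row Y" _ "dim_col Y" _ "dim_col Y"])
qed

text \<open>Both are self-adjoint for \<open>G\<close>, so
  \<open>G * Q = G * (Q * R) = transpose_mat (R * Q) * G = G * R\<close>. This transfers
  measurability from the Gram-Schmidt formula to the pseudoinverse formula.\<close>

lemma oproj_unique:
  assumes G: "sym_pos_def m G" and Y: "dim_col Y = m"
    and Q: "oproj G Y Q" and R: "oproj G Y R"
  shows "Q = R"
proof -
  obtain Gi where Gi: "Gi * G = 1\<^sub>m m" "Gi \<in> carrier_mat m m"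
    using sym_pos_def_inverse[OF G] by (metis sym_pos_def_def)
  have c: "G \<in> carrier_mat m m" "Q \<in> carrier_mat m m" "R \<in> carrier_mat m m"
    and Gt: "transpose_mat G = G"
    using G Q R Y by (auto simp: oproj_def sym_pos_def_def)
  have tQ: "transpose_mat Q * G = G * Q" and tR: "transpose_mat R * G = G * R"
    using Q R c Gt by (auto simp: oproj_def transpose_mult[of _ m m _ m])
  have "G * Q = G * (Q * R)" using oproj_absorb[OF Q R] by simp
  also have "\<dots> = transpose_mat Q * (transpose_mat R * G)"
  proof -
    have "G * (Q * R) = transpose_mat Q * G * R" using c by (simp add: tQ)
    then show ?thesis using c by (simp add: tR)
  qed
  also have "\<dots> = transpose_mat (R * Q) * G"
    using c by (simp add: transpose_mult[of _ m m _ m] assoc_mult_mat[of _ m m _ m _ m])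
  also have "\<dots> = G * R" using oproj_absorb[OF R Q] tR by simp
  finally have "Gi * G * Q = Gi * G * R" using c Gi(2) by (simp add: assoc_mult_mat[of _ m m _ m _ m])
  then show ?thesis using c Gi by simp
qed

text \<open>
  The rows of \<open>Y\<close> are processed one at a time as columns \<open>y k\<close>, with \<open>K = G\<^sup>-\<^sup>1\<close>.  If \<open>r = 0\<close> then \<open>s = 0\<close>, and
  \<open>1 / 0 = 0\<close> leaves \<open>Q\<close> unchanged; so rows depending on earlier ones need no case distinction.
\<close>

primrec gram_proj :: "nat \<Rightarrow> real mat \<Rightarrow> (nat \<Rightarrow> real mat) \<Rightarrow> nat \<Rightarrow> real mat" where
  "gram_proj m K y 0 = 0\<^sub>m m m"
| "gram_proj m K y (Suc k) =
    (let Q = gram_proj m K y k; r = (1\<^sub>m m - transpose_mat Q) * y k;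
         s = (transpose_mat r * K * r) $$ (0, 0)
     in Q + (1 / s) \<cdot>\<^sub>m (K * r * transpose_mat r))"

lemma smult_zero_mat [simp]: "(c :: real) \<cdot>\<^sub>m 0\<^sub>m a b = 0\<^sub>m a b"
  by (rule eq_matI) auto

lemma mat_1_1_eq_smult: "X \<in> carrier_mat 1 1 \<Longrightarrow> (X $$ (0,0)) \<cdot>\<^sub>m 1\<^sub>m 1 = X" for X :: "real mat"
  by (rule eq_matI) auto

text \<open>The residual \<open>r\<close> of a new row is annihilated by the projection
  \<open>Q\<close> built so far. Hence the rank-one update is a projection orthogonal to
  \<open>Q\<close>, and the sum is a projection that also fixes the new row.\<close>

lemma oproj_gram_proj:
  assumes G: "sym_pos_def m G" and GK: "G * K = 1\<^sub>m m" "K * G = 1\<^sub>m m" and K: "sym_pos_def m K"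
    and Y: "Y \<in> carrier_mat t m"
    and y: "\<And>k. k < t \<Longrightarrow> y k = transpose_mat (mat 1 m (\<lambda>(_, j). Y $$ (k, j)))"
  shows "oproj G Y (gram_proj m K y t)"
proof -
  note assoc = assoc_mult_mat[of _ m m _ m _ m] assoc_mult_mat[of _ m m _ m _ 1]
    assoc_mult_mat[of _ m m _ 1 _ m] assoc_mult_mat[of _ m 1 _ m _ m] assoc_mult_mat[of _ 1 m _ m _ m]
    assoc_mult_mat[of _ m 1 _ m _ 1] assoc_mult_mat[of _ m m _ 1 _ 1] assoc_mult_mat[of _ m 1 _ 1 _ m]
    assoc_mult_mat[of _ 1 m _ m _ 1] assoc_mult_mat[of _ 1 m _ 1 _ m]
    assoc_mult_mat[of _ m t _ m _ m] assoc_mult_mat[of _ m 1 _ t _ m] assoc_mult_mat[of _ 1 m _ t _ m]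
  have Gc: "G \<in> carrier_mat m m" and Gt: "transpose_mat G = G"
    and Kc: "K \<in> carrier_mat m m" and Kt: "transpose_mat K = K"
    using G K by (auto simp: sym_pos_def_def)
  note One_nat_def [simp del]
  define yt where "yt k = transpose_mat (y k)" for k
  have ytc: "yt k \<in> carrier_mat 1 m" and yc: "y k \<in> carrier_mat m 1"
    and yty: "transpose_mat (yt k) = y k" if "k < t" for k
    using y[OF that] by (auto simp: yt_def)
  \<comment> \<open>The factor \<open>L\<close> refers to all of \<open>Y\<close>, so its shape does
    not depend on \<open>k\<close>; only the set of fixed rows grows.\<close>
  have "gram_proj m K y k \<in> carrier_mat m m \<and>
    gram_proj m K y k * gram_proj m K y k = gram_proj m K y k \<and>
    (\<exists>L \<in> carrier_mat m t. gram_proj m K y k = L * Y) \<and>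
    transpose_mat (G * gram_proj m K y k) = G * gram_proj m K y k \<and>
    (\<forall>i<k. yt i * gram_proj m K y k = yt i)" if "k \<le> t" for k
    using that
  proof (induction k)
    case 0
    have "\<exists>L \<in> carrier_mat m t. 0\<^sub>m m m = L * Y" by (rule bexI[of _ "0\<^sub>m m t"]) (use Y in auto)
    then show ?case using Gc by simp
  next
    case (Suc k)
    define Q where "Q = gram_proj m K y k"
    define r where "r = (1\<^sub>m m - transpose_mat Q) * y k"
    define s where "s = (transpose_mat r * K * r) $$ (0, 0)"
    define Q' where "Q' = Q + (1 / s) \<cdot>\<^sub>m (K * r * transpose_mat r)"
    have Q': "gram_proj m K y (Suc k) = Q'" by (simp add: Q'_def s_def r_def Q_def Let_def)
    have k: "k < t" using Suc by simp
    from Suc obtain L where Qc: "Q \<in> carrier_mat m m" and QQ: "Q * Q = Q" and L: "L \<in> carrier_mat m t" "Q = L * Y"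
      and GQ: "transpose_mat (G * Q) = G * Q" and yQ: "\<And>i. i < k \<Longrightarrow> yt i * Q = yt i"
      by (auto simp: Q_def)
    note yk = ytc[OF k] yc[OF k] yty[OF k]
    have rc: "r \<in> carrier_mat m 1" unfolding r_def
      using Qc yk by (intro mult_carrier_mat[of _ m m]) auto
    have rt: "transpose_mat r = yt k - yt k * Q"
      using Qc yk by (simp add: r_def minus_carrier_mat transpose_mult[of _ m m _ 1] transpose_minus[of _ m m] yt_def mult_minus_distrib_mat[of _ 1 m _ m])
    have rQ: "transpose_mat r * Q = 0\<^sub>m 1 m"
      using Qc yk QQ unfolding rt by (simp add: minus_mult_distrib_mat[of _ 1 m _ _ m] assoc)
    have QtG: "transpose_mat Q * G = G * Q"
      using GQ Gc Qc Gt by (simp add: transpose_mult[of _ m m _ m])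
    \<comment> \<open>Obtained from \<open>QtG\<close> by multiplying with \<open>K\<close> on both
      sides. It moves \<open>Q\<close> past \<open>K\<close>, which puts \<open>K * r\<close> into
      the kernel of \<open>Q\<close>.\<close>
    have QK: "Q * K = K * transpose_mat Q"
    proof -
      have "K * (G * Q) * K = K * (transpose_mat Q * G) * K" by (simp add: QtG)
      then have "K * G * (Q * K) = K * transpose_mat Q * (G * K)"
        using Gc Kc Qc by (simp add: assoc)
      then show ?thesis using GK Kc Qc by simp
    qed
    have QKr: "Q * (K * r) = 0\<^sub>m m 1"
    proof -
      have "Q * (K * r) = Q * K * r" using rc Kc Qc by simp
      also have "\<dots> = K * (transpose_mat Q * r)" using rc Kc Qc by (simp add: QK)
      also have "transpose_mat Q * r = transpose_mat (transpose_mat r * Q)"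
        using rc Qc by (simp add: transpose_mult[of _ 1 m _ m])
      finally show ?thesis using Kc by (simp add: rQ)
    qed
    have ss: "transpose_mat r * (K * r) = s \<cdot>\<^sub>m 1\<^sub>m 1"
    proof -
      have "transpose_mat r * K * r = transpose_mat r * (K * r)" using rc Kc by (simp add: assoc)
      moreover have "transpose_mat r * (K * r) \<in> carrier_mat 1 1" using rc Kc by simp
      ultimately show ?thesis unfolding s_def using mat_1_1_eq_smult by simp
    qed
    \<comment> \<open>\<open>s\<close> is the squared norm of the residual in the form
      \<open>K\<close>, so \<open>s = 0\<close> forces \<open>r = 0\<close>, and then the update is
      zero.\<close>
    have s0: "s \<noteq> 0 \<or> r = 0\<^sub>m m 1"
    proof (rule disjCI)
      assume "\<not> r = 0\<^sub>m m 1"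
      show "s \<noteq> 0"
      proof
        assume "s = 0"
        then have "transpose_mat r * K * transpose_mat (transpose_mat r) = 0\<^sub>m 1 1"
          using ss rc Kc by (simp add: assoc) (rule eq_matI, auto)
        from congruence_eq_0D[OF K _ this] rc have "transpose_mat r = 0\<^sub>m 1 m" by simp
        then have "r = 0\<^sub>m m 1" by (metis transpose_transpose zero_transpose_mat)
        then show False using \<open>\<not> r = 0\<^sub>m m 1\<close> by simp
      qed
    qed
    have u: "(1/s) \<cdot>\<^sub>m (K * r * transpose_mat r) \<in> carrier_mat m m" using rc Kc by simp
    show ?case unfolding Q'
    proof (intro conjI allI impI)
      show "Q' \<in> carrier_mat m m" using Qc u by (simp add: Q'_def)
      show "Q' * Q' = Q'"
      proof (cases "r = 0\<^sub>m m 1")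
        case True
        then have "Q' = Q" using Qc Kc unfolding Q'_def by simp
        then show ?thesis using QQ by simp
      next
        case False
        with s0 have s: "s \<noteq> 0" by simp
        \<comment> \<open>The cross terms vanish, and \<open>3\<close> says that the update is
          idempotent after division by \<open>s\<close>.\<close>
        have 1: "Q * (K * r * transpose_mat r) = 0\<^sub>m m m"
        proof -
          have "Q * (K * r * transpose_mat r) = Q * (K * r) * transpose_mat r"
            using Qc Kc rc by (simp add: assoc)
          then show ?thesis using rc by (simp add: QKr)
        qed
        have 2: "K * r * transpose_mat r * Q = 0\<^sub>m m m"
          using Qc Kc rc by (simp add: assoc rQ)
        have 3: "K * r * transpose_mat r * (K * r * transpose_mat r) = s \<cdot>\<^sub>m (K * r * transpose_mat r)"
        proof -
          have "K * r * transpose_mat r * (K * r * transpose_mat r) = K * r * (transpose_mat r * (K * r)) * transpose_mat r"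
            using Qc Kc rc by (simp add: assoc)
          then show ?thesis using rc Kc unfolding ss
        by (simp add: mult_smult_distrib[of _ m 1 _ 1] mult_smult_assoc_mat[of _ m 1 _ m])
        qed
        define U where "U = K * r * transpose_mat r"
        have Uc: "U \<in> carrier_mat m m" using Kc rc by (simp add: U_def)
        note U = 1[folded U_def] 2[folded U_def] 3[folded U_def]
        have "Q' * Q' = Q * Q + (1/s) \<cdot>\<^sub>m ((1/s) \<cdot>\<^sub>m (s \<cdot>\<^sub>m U))"
          unfolding Q'_def U_def[symmetric] using Qc Uc
          by (simp add: add_mult_distrib_mat[of _ m m _ _ m] mult_add_distrib_mat[of _ m m _ m] mult_smult_distrib[of _ m m _ m]
             mult_smult_assoc_mat[of _ m m _ m] U)
        also have "\<dots> = Q * Q + (1/s) \<cdot>\<^sub>m U" using s Uc Qc by (intro eq_matI) auto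
        finally have "Q' * Q' = Q * Q + (1/s) \<cdot>\<^sub>m (K * r * transpose_mat r)" by (simp only: U_def)
        then show ?thesis using QQ by (simp add: Q'_def)
      qed
      show "\<exists>L\<in>carrier_mat m t. Q' = L * Y"
      proof -
        \<comment> \<open>The unit row \<open>e\<close> selects row \<open>k\<close> of
          \<open>Y\<close>; replacing \<open>Q\<close> by \<open>L * Y\<close> then exhibits the
          residual as \<open>f * Y\<close>.\<close>
        define e where "e = mat 1 t (\<lambda>(_, j). if j = k then 1 else 0 :: real)"
        have e: "e \<in> carrier_mat 1 t" by (simp add: e_def)
        have ey: "e * Y = yt k"
        proof (rule eq_matI)
          fix i j assume "i < dim_row (yt k)" "j < dim_col (yt k)"
          then have ij: "i = 0" "j < m" using yk by auto
          have "(e * Y) $$ (i,j) = (\<Sum>l\<in>{0..<t}. (if l = k then 1 else 0) * Y $$ (l,j))"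
            using ij Y by (simp add: e_def scalar_prod_def)
          also have "\<dots> = (\<Sum>l\<in>{0..<t}. if l = k then Y $$ (l,j) else 0)"
            by (rule sum.cong) auto
          also have "\<dots> = Y $$ (k,j)" using k by simp
          finally show "(e * Y) $$ (i,j) = yt k $$ (i,j)" using ij y[OF k] by (simp add: yt_def)
        qed (use yk Y in \<open>auto simp: e_def\<close>)
        have "transpose_mat r = (e - e * Y * L) * Y"
          using e L Y unfolding rt ey[symmetric]
          by (simp add: minus_mult_distrib_mat[of _ 1 t _ _ m] assoc_mult_mat[of _ 1 t _ m _ m]
             assoc_mult_mat[of _ 1 t _ m _ t] assoc_mult_mat[of _ m t _ m _ m] assoc_mult_mat[of _ t m _ t _ m]
             assoc_mult_mat[of _ 1 t _ t _ m])
        moreover define f where "f = e - e * Y * L"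
        ultimately have rf: "transpose_mat r = f * Y" by simp
        have f: "f \<in> carrier_mat 1 t" unfolding f_def
          using e L Y by (intro minus_carrier_mat mult_carrier_mat[of _ 1 m] mult_carrier_mat[of _ 1 t _ m])
        have "Q' = (L + (1/s) \<cdot>\<^sub>m (K * r * f)) * Y"
          using L Y f Kc rc unfolding Q'_def rf L(2)
          by (simp add: add_mult_distrib_mat[of _ m t _ _ m] mult_smult_assoc_mat[of _ m t _ m]
            assoc_mult_mat[of _ m 1 _ t _ m] assoc_mult_mat[of _ m m _ t _ m] assoc_mult_mat[of _ m m _ 1 _ m])
        then show ?thesis using L f Kc rc by (intro bexI[of _ "L + (1/s) \<cdot>\<^sub>m (K * r * f)"]) auto
      qed
      show "transpose_mat (G * Q') = G * Q'"
      proof -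
        have "G * (K * r * transpose_mat r) = r * transpose_mat r"
        proof -
          have "G * (K * r * transpose_mat r) = (G * K) * (r * transpose_mat r)"
            using Gc Kc rc by (simp add: assoc)
          then show ?thesis using rc GK by simp
        qed
        then have e: "G * Q' = G * Q + (1/s) \<cdot>\<^sub>m (r * transpose_mat r)"
          using Gc Qc u rc Kc by (simp add: Q'_def mult_add_distrib_mat[of _ m m _ m] mult_smult_distrib[of _ m m _ m])
        have "transpose_mat ((1/s) \<cdot>\<^sub>m (r * transpose_mat r)) = (1/s) \<cdot>\<^sub>m transpose_mat (r * transpose_mat r)"
          by (rule eq_matI) auto
        then show ?thesis unfolding e using Gc Qc rc GQ
          by (simp add: transpose_add[of _ m m] transpose_mult[of _ m 1 _ m])
      qed
    next
      fix i assume i: "i < Suc k"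
      then have it: "i < t" using k by simp
      have "yt i * Q' = yt i * Q + (1/s) \<cdot>\<^sub>m (yt i * (K * r) * transpose_mat r)"
        using Qc u rc Kc ytc[OF it] by (simp add: Q'_def mult_add_distrib_mat[of _ 1 m _ m] mult_smult_distrib[of _ 1 m _ m] assoc)
      also have "\<dots> = yt i"
      proof (cases "i = k")
        case True
        \<comment> \<open>Since \<open>Q * (K * r)\<close> is zero, pairing the row with
          \<open>K * r\<close> gives \<open>s\<close>, so the update adds exactly the missing part
          \<open>transpose_mat r\<close> of the row.\<close>
        have "transpose_mat r * (K * r) = yt k * (K * r) - yt k * (Q * (K * r))"
          unfolding rt using Qc rc Kc yk by (simp add: minus_mult_distrib_mat[of _ 1 m _ _ 1] assoc)
        also have "\<dots> = yt k * (K * r)" using yk rc Kc unfolding QKr by auto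
        finally have "yt i * (K * r) = s \<cdot>\<^sub>m 1\<^sub>m 1" using ss True by simp
        then have "(1/s) \<cdot>\<^sub>m (yt i * (K * r) * transpose_mat r) = transpose_mat r"
          using s0 rc by (auto simp: mult_smult_assoc_mat[of _ 1 1 _ m])
        then show ?thesis using True rt yk Qc by auto
      next
        case False
        then have "i < k" using i by simp
        \<comment> \<open>An earlier row equals its product with \<open>Q\<close>, and
          \<open>Q\<close> kills \<open>K * r\<close>.\<close>
        then have "yt i * (K * r) = yt i * Q * (K * r)" by (simp add: yQ)
        also have "\<dots> = 0\<^sub>m 1 1" using ytc[OF it] Qc rc Kc by (simp add: assoc QKr)
        finally show ?thesis using rc ytc[OF it] yQ[OF \<open>i < k\<close>] by auto
      qed
      finally show "yt i * Q' = yt i" .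
    qed
  qed
  from this[of t] obtain L where Qc: "gram_proj m K y t \<in> carrier_mat m m"
    and L: "L \<in> carrier_mat m t" "gram_proj m K y t = L * Y"
    and GQ: "transpose_mat (G * gram_proj m K y t) = G * gram_proj m K y t"
    and yQ: "\<And>i. i<t \<Longrightarrow> yt i * gram_proj m K y t = yt i" by auto
  have "Y * gram_proj m K y t = Y"
  proof (rule eq_matI)
    fix i j assume "i < dim_row Y" "j < dim_col Y"
    then have ij: "i < t" "j < m" using Y by auto
    have rr: "row (yt i) 0 = row Y i" using y[OF ij(1)] Y ij by (auto simp: yt_def)
    have "(Y * gram_proj m K y t) $$ (i,j) = (yt i * gram_proj m K y t) $$ (0,j)"
      using ij Y Qc ytc[OF ij(1)] by (simp add: rr)
    also have "\<dots> = Y $$ (i,j)" using yQ[OF ij(1)] y[OF ij(1)] ij by (simp add: yt_def)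
    finally show "(Y * gram_proj m K y t) $$ (i,j) = Y $$ (i,j)" .
  qed (use Y Qc in auto)
  then show ?thesis unfolding oproj_def using Y Qc L GQ by auto
qed

text \<open>Used with the identity in place of \<open>G\<close> to construct pseudoinverses.\<close>

lemma oproj_exists:
  assumes G: "sym_pos_def m G" and Y: "dim_col Y = m"
  shows "\<exists>Q. oproj G Y Q"
proof -
  obtain K where K: "G * K = 1\<^sub>m m" "K * G = 1\<^sub>m m" "sym_pos_def m K"
    using sym_pos_def_inverse[OF G] by metis
  have "oproj G Y (gram_proj m K (\<lambda>k. transpose_mat (mat 1 m (\<lambda>(_, j). Y $$ (k, j)))) (dim_row Y))"
    by (rule oproj_gram_proj[OF G K]) (use Y in auto)
  then show ?thesis by blast
qed

section \<open>The pseudoinverse\<close>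

text \<open>Row and column space of a symmetric \<open>W\<close> agree, so the orthogonal projection
  \<open>Q = L * W\<close> also equals \<open>W * transpose_mat L\<close>. Sandwiching
  \<open>W\<close> between \<open>L\<close> and its transpose gives \<open>D\<close> with
  \<open>W * D = D * W = Q\<close>.\<close>

lemma is_pinv_symmetric_exists:
  assumes W: "W \<in> carrier_mat t t" and Wt: "transpose_mat W = W"
  shows "\<exists>D. is_pinv W D"
proof -
  from oproj_exists[OF sym_pos_def_one, of W t] W
  obtain Q where "oproj (1\<^sub>m t) W Q" by auto
  then obtain L where Q: "Q \<in> carrier_mat t t" "W * Q = W" "transpose_mat Q = Q"
    and L: "L \<in> carrier_mat t t" "Q = L * W"
    using W by (auto simp: oproj_def)
  note assoc = assoc_mult_mat[of _ t t _ t _ t]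
  note tm = transpose_mult[of _ t t _ t]
  define T where "T = transpose_mat L"
  have T: "T \<in> carrier_mat t t" using L by (simp add: T_def)
  have QW: "Q * W = W" using transpose_mult[OF W Q(1)] by (simp add: Q Wt)
  have WT: "W * T = Q" using arg_cong[OF L(2), of transpose_mat] Q L W Wt by (simp add: tm T_def)
  have LQ: "L * Q = Q * T" using L W T by (simp add: WT[symmetric])
  \<comment> \<open>\<open>D = L W L\<^sup>T\<close>\<close>
  define D where "D = L * Q"
  have QQ: "Q * Q = Q"
  proof -
    have "Q * Q = L * (W * Q)" using L W Q(1) by (simp add: L(2) assoc)
    then show ?thesis by (simp only: Q L(2)[symmetric])
  qed
  have WD: "W * D = Q"
  proof -
    have "W * D = W * Q * T" using W Q(1) T by (simp add: D_def LQ assoc)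
    then show ?thesis by (simp add: Q WT)
  qed
  have DW: "D * W = Q"
  proof -
    have "D * W = L * (Q * W)" using W Q(1) L(1) by (simp add: D_def assoc)
    then show ?thesis by (simp only: QW L(2)[symmetric])
  qed
  have "D * W * D = D"
  proof -
    have "D * W * D = Q * Q * T" using Q T by (simp add: DW) (simp add: D_def LQ)
    then show ?thesis by (simp add: QQ D_def LQ)
  qed
  moreover have "D \<in> carrier_mat t t" using L(1) Q(1) by (simp add: D_def)
  ultimately have "is_pinv W D"
    unfolding is_pinv_def using W WD DW QW Q(3) by auto
  then show ?thesis by blast
qed

text \<open>\<open>X * D\<close> and \<open>X * E\<close> are symmetric and absorb each other, hence
  agree; so do \<open>D * X\<close> and \<open>E * X\<close>. Then
  \<open>D = D * X * D = E * X * E = E\<close>.\<close>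

lemma is_pinv_unique:
  assumes D: "is_pinv X D" and E: "is_pinv X E"
  shows "D = E"
proof -
  define a b where "a = dim_row X" and "b = dim_col X"
  have c: "X \<in> carrier_mat a b" "D \<in> carrier_mat b a" "E \<in> carrier_mat b a"
    using D E by (auto simp: is_pinv_def a_def b_def)
  have D': "X * D * X = X" "D * X * D = D" "transpose_mat (X * D) = X * D" "transpose_mat (D * X) = D * X"
    using D by (auto simp: is_pinv_def)
  have E': "X * E * X = X" "E * X * E = E" "transpose_mat (X * E) = X * E" "transpose_mat (E * X) = E * X"
    using E by (auto simp: is_pinv_def)
  note assoc = assoc_mult_mat[of _ a b _ a _ b] assoc_mult_mat[of _ a b _ a _ a] assoc_mult_mat[of _ b a _ b _ a]
    assoc_mult_mat[of _ a a _ b _ a] assoc_mult_mat[of _ a b _ b _ a] assoc_mult_mat[of _ b a _ b _ b]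
    assoc_mult_mat[of _ b b _ a _ b] assoc_mult_mat[of _ b a _ a _ b]
  have "X * D = X * E"
  proof -
    have "X * D = transpose_mat (X * E * X * D)" by (simp only: D' E')
    also have "\<dots> = transpose_mat ((X * E) * (X * D))" using c by (simp add: assoc)
    also have "\<dots> = transpose_mat (X * D) * transpose_mat (X * E)"
      using c by (intro transpose_mult) auto
    also have "\<dots> = X * D * (X * E)" by (simp only: D' E')
    also have "\<dots> = X * D * X * E" using c by (simp add: assoc)
    finally show ?thesis by (simp only: D')
  qed
  moreover have "D * X = E * X"
  proof -
    have "D * X = transpose_mat (D * (X * E * X))" by (simp only: D' E')
    also have "\<dots> = transpose_mat ((D * X) * (E * X))" using c by (simp add: assoc)
    also have "\<dots> = transpose_mat (E * X) * transpose_mat (D * X)"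
      using c by (intro transpose_mult) auto
    also have "\<dots> = E * X * (D * X)" by (simp only: D' E')
    also have "\<dots> = E * (X * D * X)" using c by (simp add: assoc)
    finally show ?thesis by (simp only: D')
  qed
  ultimately have "D * X * D = E * X * E" using c by (simp add: assoc)
  then show ?thesis by (simp only: D' E')
qed

text \<open>Resolves the definite description in \<open>pinv\<close> for the Gram matrices to which
  it is applied.\<close>

lemma is_pinv_pinv_symmetric:
  assumes W: "W \<in> carrier_mat t t" and Wt: "transpose_mat W = W"
  shows "is_pinv W (pinv W)"
  unfolding pinv_def
  using is_pinv_symmetric_exists[OF assms] is_pinv_unique by (metis theI)

text \<open>Everything rests on \<open>W * F * Y = Y\<close> for each \<open>F\<close> with
  \<open>W * F * W = W\<close>, applied to the pseudoinverse \<open>D\<close> of \<open>W\<close>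
  and to its transpose.\<close>

lemma oproj_pinv:
  assumes G: "sym_pos_def m G" and K: "sym_pos_def m K" and GK: "G * K = 1\<^sub>m m"
    and Y: "Y \<in> carrier_mat t m"
  shows "oproj G Y (K * transpose_mat Y * pinv (Y * K * transpose_mat Y) * Y)"
proof -
  define W where "W = Y * K * transpose_mat Y"
  define D where "D = pinv W"
  have c: "G \<in> carrier_mat m m" "K \<in> carrier_mat m m" and t: "transpose_mat G = G" "transpose_mat K = K"
    using G K by (auto simp: sym_pos_def_def)
  have W: "W \<in> carrier_mat t t" using c Y by (simp add: W_def)
  have Wt: "transpose_mat W = W"
    using c Y t by (simp add: W_def transpose_mult[of _ t m _ t] transpose_mult[of _ m m _ t])
  have D: "D \<in> carrier_mat t t" "W * D * W = W"
    using is_pinv_pinv_symmetric[OF W Wt] W by (auto simp: D_def is_pinv_def)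
  have Dt: "transpose_mat D \<in> carrier_mat t t" using D by simp
  have WDtW: "W * transpose_mat D * W = W"
  proof -
    have "transpose_mat (W * D * W) = W * transpose_mat D * W"
      using W D(1) Wt by (simp add: transpose_mult[of _ t t _ t])
    then show ?thesis by (simp add: D(2) Wt)
  qed
  \<comment> \<open>From \<open>N * W = 0\<close> follows
    \<open>N * Y * K * transpose_mat (N * Y) = 0\<close>; definiteness of \<open>K\<close> then
    gives \<open>N * Y = 0\<close>.\<close>
  have absorb: "W * F * Y = Y" if F: "F \<in> carrier_mat t t" "W * F * W = W" for F
  proof -
    define N where "N = W * F - 1\<^sub>m t"
    have N: "N \<in> carrier_mat t t" by (simp add: N_def minus_carrier_mat)
    have NW: "N * W = 0\<^sub>m t t"
      using W F by (simp add: N_def minus_mult_distrib_mat[of _ t t _ _ t])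
    have "N * Y * K * transpose_mat (N * Y) = N * W * transpose_mat N"
      using N Y c by (simp add: W_def transpose_mult[of _ t t _ m] assoc_mult_mat[of _ t t _ m _ t]
        assoc_mult_mat[of _ t m _ m _ t] assoc_mult_mat[of _ t m _ t _ t] assoc_mult_mat[of _ t t _ t _ t] assoc_mult_mat[of _ m m _ t _ t])
    then have "N * Y * K * transpose_mat (N * Y) = 0\<^sub>m t t" using N by (simp add: NW)
    from congruence_eq_0D[OF K _ this] N Y have "N * Y = 0\<^sub>m t m" by simp
    then have z: "W * F * Y - Y = 0\<^sub>m t m"
      using W F Y by (simp add: N_def minus_mult_distrib_mat[of _ t t _ _ m])
    show ?thesis
    proof (rule eq_matI)
      fix i j assume "i < dim_row Y" "j < dim_col Y"
      then have "(W * F * Y - Y) $$ (i,j) = (W * F * Y) $$ (i,j) - Y $$ (i,j)" by simp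
      then show "(W * F * Y) $$ (i,j) = Y $$ (i,j)"
        using z Y \<open>i < dim_row Y\<close> \<open>j < dim_col Y\<close> by simp
    qed (use W Y in auto)
  qed
  note assoc = assoc_mult_mat[of _ m m _ m _ m]
    assoc_mult_mat[of _ m m _ m _ t]
    assoc_mult_mat[of _ m m _ t _ m]
    assoc_mult_mat[of _ m m _ t _ t]
    assoc_mult_mat[of _ m t _ m _ m]
    assoc_mult_mat[of _ m t _ m _ t]
    assoc_mult_mat[of _ m t _ t _ m]
    assoc_mult_mat[of _ m t _ t _ t]
    assoc_mult_mat[of _ t m _ m _ m]
    assoc_mult_mat[of _ t m _ m _ t]
    assoc_mult_mat[of _ t m _ t _ m]
    assoc_mult_mat[of _ t m _ t _ t]
    assoc_mult_mat[of _ t t _ m _ m]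
    assoc_mult_mat[of _ t t _ m _ t]
    assoc_mult_mat[of _ t t _ t _ m]
    assoc_mult_mat[of _ t t _ t _ t]
  define Q where "Q = K * transpose_mat Y * D * Y"
  have Q: "Q \<in> carrier_mat m m" unfolding Q_def using c Y D
    by (intro mult_carrier_mat[of _ m t] mult_carrier_mat[of _ m m]) auto
  have "Y * Q = W * D * Y" using c Y D(1) by (simp add: Q_def W_def assoc)
  then have YQ: "Y * Q = Y" using absorb[OF D] by simp
  have GQ: "G * Q = transpose_mat Y * D * Y"
  proof -
    have "G * Q = G * K * (transpose_mat Y * D * Y)" using c Y D(1) by (simp add: Q_def assoc)
    then show ?thesis using Y D(1) GK by (simp add: assoc)
  qed
  \<comment> \<open>Insert \<open>W * transpose_mat D\<close> before the right \<open>Y\<close>,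
    then contract \<open>transpose_mat Y * D * W\<close> to \<open>transpose_mat Y\<close>.\<close>
  have "transpose_mat Y * D * Y = transpose_mat Y * transpose_mat D * Y"
  proof -
    have "transpose_mat (W * transpose_mat D * Y) = transpose_mat Y * D * W"
      using W Wt Y D(1) by (simp add: transpose_mult[of _ t t _ m] transpose_mult[of _ t t _ t] assoc)
    then have 1: "transpose_mat Y = transpose_mat Y * D * W" by (simp only: absorb[OF Dt WDtW])
    have "transpose_mat Y * D * Y = transpose_mat Y * D * (W * transpose_mat D * Y)"
      by (simp only: absorb[OF Dt WDtW])
    also have "\<dots> = transpose_mat Y * D * W * transpose_mat D * Y" using Y D(1) W by (simp add: assoc)
    finally show ?thesis by (simp only: 1[symmetric])
  qed
  then have "transpose_mat (G * Q) = G * Q"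
    unfolding GQ using Y D(1) by (simp add: assoc transpose_mult[of _ m t _ m] transpose_mult[of _ m t _ t] transpose_mult[of _ t t _ m])
  then have "oproj G Y Q" unfolding oproj_def using Q YQ Y c D
    by (auto intro!: bexI[of _ "K * transpose_mat Y * D"] simp: Q_def)
  then show ?thesis by (simp add: Q_def D_def W_def)
qed

section \<open>The matrices \<open>Z1\<close> and \<open>Z2\<close> as projections\<close>

lemma oproj_Z1:
  assumes G: "sym_pos_def m G" and A: "A \<in> carrier_mat p m" and S: "S \<in> carrier_mat p t"
  shows "oproj G (transpose_mat S * A) (Z1 A G S)"
proof -
  obtain K where K: "mat_inverse G = Some K" "G * K = 1\<^sub>m m" "sym_pos_def m K" using sym_pos_def_inverse[OF G] by metis
  have Kc: "K \<in> carrier_mat m m" using K by (simp add: sym_pos_def_def)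
  \<comment> \<open>In terms of \<open>Y\<close> the Gram matrix inside \<open>pinv\<close> is
    \<open>Y * K * transpose_mat Y\<close>; what remains is reassociation.\<close>
  define Y where "Y = transpose_mat S * A"
  have Y: "Y \<in> carrier_mat t m" using A S by (simp add: Y_def)
  have Yt: "transpose_mat Y = transpose_mat A * S" using A S by (simp add: Y_def transpose_mult[of _ t p _ m])
  define W where "W = Y * K * transpose_mat Y"
  have W: "W \<in> carrier_mat t t" using Y Kc by (simp add: W_def)
  have Kt: "transpose_mat K = K" using K(3) by (simp add: sym_pos_def_def)
  have Wt: "transpose_mat W = W" using Y Kc
    by (simp add: W_def transpose_mult[of _ t m _ t] transpose_mult[of _ m m _ t] Kt)
  have D: "pinv W \<in> carrier_mat t t" using is_pinv_pinv_symmetric[OF W Wt] W by (simp add: is_pinv_def)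
  have W': "transpose_mat S * A * K * transpose_mat A * S = W"
    using A S Kc by (simp add: W_def Yt) (simp add: Y_def assoc_mult_mat[of _ t m _ m _ p] assoc_mult_mat[of _ t p _ m _ p]
       assoc_mult_mat[of _ t p _ m _ m] assoc_mult_mat[of _ t p _ m _ t] assoc_mult_mat[of _ t p _ p _ t] assoc_mult_mat[of _ m m _ p _ t]
       assoc_mult_mat[of _ p m _ p _ t] assoc_mult_mat[of _ p m _ m _ p]  assoc_mult_mat[of _ p m _ m _ t])
  have "Z1 A G S = K * transpose_mat A * S * pinv W * transpose_mat S * A"
    by (simp add: Z1_def Let_def K(1) W')
  also have "\<dots> = K * transpose_mat Y * pinv W * Y"
    using A S Kc D by (simp add: Yt) (simp add: Y_def assoc_mult_mat[of _ m m _ p _ t] assoc_mult_mat[of _ m t _ t _ m]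
      assoc_mult_mat[of _ m p _ t _ t] assoc_mult_mat[of _ m p _ t _ p] assoc_mult_mat[of _ m p _ t _ m] assoc_mult_mat[of _ m t _ t _ p] assoc_mult_mat[of _ m t _ p _ m]
      assoc_mult_mat[of _ m m _ p _ m] assoc_mult_mat[of _ m m _ t _ m] assoc_mult_mat[of _ m m _ t _ t] assoc_mult_mat[of _ m m _ t _ p]
      assoc_mult_mat[of _ m m _ p _ p] assoc_mult_mat[of _ m p _ p _ m] assoc_mult_mat[of _ p t _ t _ m] assoc_mult_mat[of _ p t _ t _ p]
      assoc_mult_mat[of _ p t _ p _ m])
  finally show ?thesis using oproj_pinv[OF G K(3,2) Y] by (simp add: W_def Y_def)
qed

text \<open>The case where \<open>G\<close> and \<open>K\<close> are the identity; identity factors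
  are inserted to match the general formula.\<close>

lemma oproj_Z2:
  assumes B: "B \<in> carrier_mat n q" and P: "P \<in> carrier_mat q t"
  shows "oproj (1\<^sub>m n) (transpose_mat P * transpose_mat B) (Z2 B P)"
proof -
  define Y where "Y = transpose_mat P * transpose_mat B"
  have Y: "Y \<in> carrier_mat t n" using B P by (simp add: Y_def)
  have Yt: "transpose_mat Y = B * P" using B P by (simp add: Y_def transpose_mult[of _ t q _ n])
  define W where "W = Y * 1\<^sub>m n * transpose_mat Y"
  have W: "W \<in> carrier_mat t t" using Y by (simp add: W_def)
  have Wt: "transpose_mat W = W" using Y by (simp add: W_def transpose_mult[of _ t n _ t])
  have D: "pinv W \<in> carrier_mat t t" using is_pinv_pinv_symmetric[OF W Wt] W by (simp add: is_pinv_def)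
  have W': "transpose_mat P * transpose_mat B * B * P = W"
    using B P Y by (simp add: W_def Yt) (simp add: Y_def assoc_mult_mat[of _ t n _ q _ t] assoc_mult_mat[of _ t q _ q _ t]
      assoc_mult_mat[of _ t q _ n _ t] assoc_mult_mat[of _ q n _ q _ t] assoc_mult_mat[of _ t q _ n _ q])
  have "Z2 B P = B * P * pinv W * transpose_mat P * transpose_mat B"
    by (simp add: Z2_def Let_def W')
  also have "\<dots> = 1\<^sub>m n * transpose_mat Y * pinv W * Y"
    using B P D Y by (simp add: Yt) (simp add: Y_def assoc_mult_mat[of _ n t _ t _ n] assoc_mult_mat[of _ n t _ t _ q] assoc_mult_mat[of _ n t _ q _ n])
  finally show ?thesis using oproj_pinv[OF sym_pos_def_one sym_pos_def_one _ Y] by (simp add: W_def Y_def)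
qed

section \<open>Kronecker products\<close>

lemma dim_kron [simp]: "dim_row (kron X Y) = dim_row X * dim_row Y" "dim_col (kron X Y) = dim_col X * dim_col Y"
  by (auto simp: kron_def)

lemma kron_carrier [simp]:
  "X \<in> carrier_mat a b \<Longrightarrow> Y \<in> carrier_mat c d \<Longrightarrow> kron X Y \<in> carrier_mat (a * c) (b * d)"
  by (auto simp: kron_def)

lemma index_kron:
  "i < dim_row X * dim_row Y \<Longrightarrow> j < dim_col X * dim_col Y \<Longrightarrow>
   kron X Y $$ (i,j) = X $$ (i div dim_row Y, j div dim_col Y) * Y $$ (i mod dim_row Y, j mod dim_col Y)"
  by (simp add: kron_def)

lemma div_mod_less:
  assumes "i < a * (b::nat)" shows "i div b < a" "i mod b < b"
  using assms by (auto simp: less_mult_imp_div_less) (metis mod_less_divisor mult_0_right not_less_zero zero_less_iff_neq_zero)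

lemma mult_add_less:
  assumes "i < a" "j < (b::nat)" shows "i * b + j < a * b"
proof -
  have "i * b + j < Suc i * b" using assms by simp
  also have "\<dots> \<le> a * b" using assms by (intro mult_le_mono1) simp
  finally show ?thesis .
qed

text \<open>Reindexing along \<open>k = i * b + j\<close>, the pairing of indices behind
  \<open>kron\<close>.\<close>

lemma sum_div_mod:
  fixes f :: "nat \<Rightarrow> nat \<Rightarrow> 'a :: comm_monoid_add"
  shows "(\<Sum>k<a * b. f (k div b) (k mod b)) = (\<Sum>i<a. \<Sum>j<b. f i j)"
proof -
  have "(\<Sum>k<a * b. f (k div b) (k mod b)) = (\<Sum>(i,j)\<in>{..<a} \<times> {..<b}. f i j)"
    by (rule sum.reindex_bij_witness[of _ "\<lambda>(i,j). i * b + j" "\<lambda>k. (k div b, k mod b)"])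
      (auto simp: div_mod_less mult_add_less)
  then show ?thesis by (simp add: sum.cartesian_product)
qed

lemma transpose_kron: "transpose_mat (kron X Y) = kron (transpose_mat X) (transpose_mat Y)"
  by (rule eq_matI) (auto simp: index_kron div_mod_less)

text \<open>The mixed-product rule: the sum over a paired index splits into a product of two
  sums.\<close>

lemma kron_mult:
  assumes "X \<in> carrier_mat a b" "X' \<in> carrier_mat b c" "Y \<in> carrier_mat d e" "Y' \<in> carrier_mat e f"
  shows "kron X Y * kron X' Y' = kron (X * X') (Y * Y')"
proof (rule eq_matI)
  fix i j assume "i < dim_row (kron (X * X') (Y * Y'))" "j < dim_col (kron (X * X') (Y * Y'))"
  then have ij: "i < a * d" "j < c * f" using assms by auto
  note dm = div_mod_less[OF ij(1)] div_mod_less[OF ij(2)]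
  have "(kron X Y * kron X' Y') $$ (i,j) = (\<Sum>k<b * e. kron X Y $$ (i,k) * kron X' Y' $$ (k,j))"
    using assms ij by (simp add: scalar_prod_def lessThan_atLeast0)
  also have "\<dots> = (\<Sum>k<b * e. (X $$ (i div d, k div e) * X' $$ (k div e, j div f)) *
      (Y $$ (i mod d, k mod e) * Y' $$ (k mod e, j mod f)))"
    using assms ij by (intro sum.cong refl) (auto simp: index_kron)
  also have "\<dots> = (\<Sum>k<b. \<Sum>l<e. (X $$ (i div d, k) * X' $$ (k, j div f)) *
      (Y $$ (i mod d, l) * Y' $$ (l, j mod f)))"
    by (rule sum_div_mod)
  also have "\<dots> = (X * X') $$ (i div d, j div f) * (Y * Y') $$ (i mod d, j mod f)"
    using assms dm by (simp add: scalar_prod_def lessThan_atLeast0 sum_product)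
  also have "\<dots> = kron (X * X') (Y * Y') $$ (i,j)"
    using assms ij by (subst index_kron) auto
  finally show "(kron X Y * kron X' Y') $$ (i,j) = kron (X * X') (Y * Y') $$ (i,j)" .
qed (use assms in auto)

text \<open>The mixed-product rule applies to each defining equation, with \<open>kron L L'\<close>
  as the left factor.\<close>

lemma oproj_kron:
  assumes G: "G \<in> carrier_mat a a" "G' \<in> carrier_mat b b" and Y: "dim_col Y = a" "dim_col Y' = b"
    and Q: "oproj G Y Q" and R: "oproj G' Y' R"
  shows "oproj (kron G G') (kron Y Y') (kron Q R)"
proof -
  define c d where "c = dim_row Y" and "d = dim_row Y'"
  have Yc: "Y \<in> carrier_mat c a" "Y' \<in> carrier_mat d b" using Y by (auto simp: c_def d_def)
  obtain L L' where L: "L \<in> carrier_mat a c" "Q = L * Y" and L': "L' \<in> carrier_mat b d" "R = L' * Y'"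
    using Q R Y by (auto simp: oproj_def c_def d_def)
  have c: "Q \<in> carrier_mat a a" "R \<in> carrier_mat b b" using Q R Y by (auto simp: oproj_def)
  have "kron Q R = kron L L' * kron Y Y'"
    using L L' Yc by (simp add: kron_mult[of _ a c _ a _ b d _ b])
  moreover have "kron Y Y' * kron Q R = kron Y Y'"
    using Q R Yc c by (simp add: kron_mult[of _ c a _ a _ d b _ b] oproj_def)
  moreover have "kron G G' * kron Q R = kron (G * Q) (G' * R)"
    using c G by (simp add: kron_mult[of _ a a _ a _ b b _ b])
  ultimately show ?thesis unfolding oproj_def
    using L L' c Q R Y by (auto simp: transpose_kron oproj_def c_def d_def intro!: bexI[of _ "kron L L'"])
qed

text \<open>Cut \<open>v\<close> into \<open>n\<close> blocks of length \<open>m\<close>: its form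
  is the sum of the forms of \<open>G\<close> at the blocks, and a nonzero \<open>v\<close> has a
  nonzero block.\<close>

lemma sym_pos_def_kron_one:
  assumes G: "sym_pos_def m G"
  shows "sym_pos_def (n * m) (kron (1\<^sub>m n) G)"
proof -
  have Gc: "G \<in> carrier_mat m m" "transpose_mat G = G" using G by (auto simp: sym_pos_def_def)
  have "scalar_prod v (kron (1\<^sub>m n) G *\<^sub>v v) > 0" if v: "v \<in> carrier_vec (n * m)" "v \<noteq> 0\<^sub>v (n * m)" for v
  proof -
    define b where "b i = vec m (\<lambda>j. v $ (i * m + j))" for i
    have b: "b i \<in> carrier_vec m" for i by (simp add: b_def)
    have nonneg: "scalar_prod (b i) (G *\<^sub>v b i) \<ge> 0" for i
      using G Gc b[of i] unfolding sym_pos_def_def by (cases "b i = 0\<^sub>v m") (auto intro: less_imp_le)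
    have "\<exists>k<n * m. v $ k \<noteq> 0" using v by (metis carrier_vecD eq_vecI index_zero_vec)
    then obtain k where k: "k < n * m" "v $ k \<noteq> 0" by blast
    have "b (k div m) \<noteq> 0\<^sub>v m"
    proof
      assume "b (k div m) = 0\<^sub>v m"
      then have "b (k div m) $ (k mod m) = 0" using div_mod_less(2)[OF k(1)] by simp
      then show False using k div_mod_less(2)[OF k(1)] by (simp add: b_def)
    qed
    then have pos: "scalar_prod (b (k div m)) (G *\<^sub>v b (k div m)) > 0"
      using G b unfolding sym_pos_def_def by blast
    have "scalar_prod v (kron (1\<^sub>m n) G *\<^sub>v v) =
       (\<Sum>i<n*m. \<Sum>j<n*m. v $ i * kron (1\<^sub>m n) G $$ (i,j) * v $ j)"
      using v Gc by (simp add: scalar_prod_def lessThan_atLeast0 sum_distrib_left mult.assoc)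
    also have "\<dots> = (\<Sum>i<n*m. \<Sum>j<n*m. v $ (i div m * m + i mod m) * ((if i div m = j div m then 1 else 0) * G $$ (i mod m, j mod m)) * v $ (j div m * m + j mod m))"
      using Gc by (intro sum.cong refl) (auto simp: index_kron div_mod_less)
    also have "\<dots> = (\<Sum>i<n. \<Sum>j<m. \<Sum>i'<n. \<Sum>j'<m. v $ (i * m + j) * ((if i = i' then 1 else 0) * G $$ (j, j')) * v $ (i' * m + j'))"
      by (simp only: sum_div_mod[where f = "\<lambda>i' j'. v $ (i * m + j) * ((if i = i' then 1 else 0) * G $$ (j, j')) * v $ (i' * m + j')" for i j]
         sum_div_mod[where f = "\<lambda>i j. \<Sum>i'<n. \<Sum>j'<m. v $ (i * m + j) * ((if i = i' then 1 else 0) * G $$ (j, j')) * v $ (i' * m + j')"])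
    \<comment> \<open>The identity factor couples only equal block indices.\<close>
    also have "\<dots> = (\<Sum>i<n. \<Sum>j<m. \<Sum>i'<n. if i = i' then \<Sum>j'<m. v $ (i * m + j) * G $$ (j, j') * v $ (i' * m + j') else 0)"
      by (intro sum.cong refl) auto
    also have "\<dots> = (\<Sum>i<n. \<Sum>j<m. \<Sum>j'<m. v $ (i * m + j) * G $$ (j, j') * v $ (i * m + j'))"
      by simp
    also have "\<dots> = (\<Sum>i<n. scalar_prod (b i) (G *\<^sub>v b i))"
      using Gc by (simp add: b_def scalar_prod_def lessThan_atLeast0 sum_distrib_left mult.assoc)
    also have "\<dots> \<ge> scalar_prod (b (k div m)) (G *\<^sub>v b (k div m))"
      by (rule member_le_sum) (use nonneg div_mod_less[OF k(1)] in auto)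
    finally show ?thesis using pos by simp
  qed
  then show ?thesis using Gc unfolding sym_pos_def_def by (auto simp: transpose_kron)
qed

section \<open>Trace and rank\<close>

text \<open>Polymorphic, since it is taken of real matrices and of a complex triangular
  form.\<close>

definition mtrace :: "'a :: comm_monoid_add mat \<Rightarrow> 'a" where
  "mtrace X = (\<Sum>i<dim_row X. X $$ (i, i))"

lemma mtrace_comm:
  assumes "X \<in> carrier_mat a b" "Y \<in> carrier_mat b a"
  shows "mtrace (X * Y) = mtrace (Y * X :: 'a :: comm_semiring_0 mat)"
proof -
  have "mtrace (X * Y) = (\<Sum>i<a. \<Sum>k<b. X $$ (i,k) * Y $$ (k,i))"
    using assms by (simp add: mtrace_def scalar_prod_def lessThan_atLeast0)
  also have "\<dots> = (\<Sum>k<b. \<Sum>i<a. Y $$ (k,i) * X $$ (i,k))"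
    by (subst sum.swap) (simp add: mult.commute)
  also have "\<dots> = mtrace (Y * X)"
    using assms by (simp add: mtrace_def scalar_prod_def lessThan_atLeast0)
  finally show ?thesis .
qed

lemma mtrace_one: "mtrace (1\<^sub>m n :: real mat) = real n"
  by (simp add: mtrace_def)

text \<open>The solutions \<open>u j\<close>, set side by side as columns, form
  \<open>R\<close>.\<close>

lemma factor_through_columns:
  assumes C: "C \<in> carrier_mat a r" and Y: "Y \<in> carrier_mat a b"
    and ex: "\<And>j. j < b \<Longrightarrow> \<exists>u \<in> carrier_vec r. C *\<^sub>v u = col Y j"
  shows "\<exists>R \<in> carrier_mat r b. Y = C * (R :: 'a :: comm_semiring_0 mat)"
proof -
  obtain u where u: "\<And>j. j < b \<Longrightarrow> u j \<in> carrier_vec r \<and> C *\<^sub>v u j = col Y j"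
    using ex by metis
  let ?R = "mat r b (\<lambda>(i,j). u j $ i)"
  have "Y = C * ?R"
  proof (rule eq_matI)
    fix i j assume "i < dim_row (C * ?R)" "j < dim_col (C * ?R)"
    then have ij: "i < a" "j < b" using C by auto
    have "col ?R j = u j" using ij u[OF ij(2)] by (intro eq_vecI) auto
    then have "(C * ?R) $$ (i,j) = (C *\<^sub>v u j) $ i" using ij C by simp
    then show "Y $$ (i,j) = (C * ?R) $$ (i,j)" using u[OF ij(2)] ij Y by simp
  qed (use C Y in auto)
  then show ?thesis by (intro bexI[of _ ?R]) auto
qed

text \<open>\<open>C\<close> collects a maximal independent set of columns of \<open>Y\<close>: that
  it spans gives \<open>R\<close>, that it consists of columns of \<open>Y\<close> gives
  \<open>U\<close>, and independence gives injectivity.\<close>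

lemma (in vec_space) rank_factorization:
  assumes Y: "Y \<in> carrier_mat n b"
  obtains C R U where "C \<in> carrier_mat n (rank Y)" "R \<in> carrier_mat (rank Y) b"
    "U \<in> carrier_mat b (rank Y)" "Y = C * R" "C = Y * U"
    "\<And>v. v \<in> carrier_vec (rank Y) \<Longrightarrow> C *\<^sub>v v = 0\<^sub>v n \<Longrightarrow> v = 0\<^sub>v (rank Y)"
proof -
  have Yc: "set (cols Y) \<subseteq> carrier_vec n" using cols_dim Y by blast
  obtain S where S: "maximal S (\<lambda>T. T \<subseteq> set (cols Y) \<and> lin_indpt T)" "finite S"
    using maximal_exists_superset[of "set (cols Y)" "\<lambda>T. T \<subseteq> set (cols Y) \<and> lin_indpt T" "{}"]
      finite_lin_indpt2 by auto
  have SY: "S \<subseteq> set (cols Y)" and li: "lin_indpt S" using S(1) by (auto simp: maximal_def)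
  have Sc: "S \<subseteq> carrier_vec n" using SY Yc by blast
  obtain xs where xs: "set xs = S" "distinct xs" using finite_distinct_list[OF S(2)] by blast
  have r: "rank Y = length xs"
    using rank_card_indpt[OF Y S(1)] distinct_card[OF xs(2)] xs(1) by simp
  define C where "C = mat_of_cols n xs"
  have C: "C \<in> carrier_mat n (rank Y)" by (simp add: C_def r)
  have colsC: "cols C = xs" using xs Sc by (simp add: C_def)
  have inS: "s \<in> span S" if s: "s \<in> set (cols Y)" for s
  proof (rule ccontr)
    \<comment> \<open>Such a column could join \<open>S\<close> without losing independence, against
      maximality.\<close>
    assume ns: "s \<notin> span S"
    have "lin_indpt (S \<union> {s})"
      using lin_dep_iff_in_span[of S s] Sc li ns s Yc span_mem[of S s] by auto
    moreover have "s \<notin> S" using ns Sc span_mem by auto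
    ultimately show False using S(1) s SY by (auto simp: maximal_def)
  qed
  have "\<exists>R \<in> carrier_mat (rank Y) b. Y = C * R"
  proof (rule factor_through_columns[OF C Y])
    fix j assume "j < b"
    then have "col Y j \<in> span S" using inS Y by (auto simp: cols_def)
    then have "col Y j \<in> col_space C" by (simp add: col_space_def colsC xs)
    then show "\<exists>u\<in>carrier_vec (rank Y). C *\<^sub>v u = col Y j" using C by (auto simp: col_space_eq[OF C])
  qed
  moreover have "\<exists>U \<in> carrier_mat b (rank Y). C = Y * U"
  proof (rule factor_through_columns[OF Y C])
    fix j assume j: "j < rank Y"
    then have "col C j \<in> set (cols C)" using C by (auto simp: cols_def)
    then have "col C j \<in> set (cols Y)" using SY by (auto simp: colsC xs)
    then have "col C j \<in> col_space Y" unfolding col_space_def using span_mem[OF Yc] by auto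
    then show "\<exists>u\<in>carrier_vec b. Y *\<^sub>v u = col C j" using Y by (auto simp: col_space_eq[OF Y])
  qed
  moreover have "v = 0\<^sub>v (rank Y)" if "v \<in> carrier_vec (rank Y)" "C *\<^sub>v v = 0\<^sub>v n" for v
    using lin_depI[OF C that(1) _ that(2)] li xs colsC by auto
  ultimately show thesis using that C by blast
qed

text \<open>With \<open>Y = C * R\<close>, cyclicity turns the trace of \<open>L * Y\<close> into
  that of \<open>V = R * L * C\<close>. Injectivity of \<open>C\<close> cancels
  \<open>C * V = C\<close> to \<open>V = 1\<^sub>m r\<close>.\<close>

lemma mtrace_oproj:
  assumes Z: "oproj G Y Z"
  shows "mtrace Z = real (mat_rank Y)"
proof -
  define a b r where "a = dim_row Y" and "b = dim_col Y" and "r = mat_rank Y"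
  have Y: "Y \<in> carrier_mat a b" by (simp add: a_def b_def)
  interpret vec_space "TYPE(real)" a .
  obtain C R U where C: "C \<in> carrier_mat a r" "R \<in> carrier_mat r b" "U \<in> carrier_mat b r"
    "Y = C * R" "C = Y * U"
    and inj: "\<And>v. v \<in> carrier_vec r \<Longrightarrow> C *\<^sub>v v = 0\<^sub>v a \<Longrightarrow> v = 0\<^sub>v r"
    using rank_factorization[OF Y] by (metis mat_rank_def a_def r_def)
  obtain L where L: "L \<in> carrier_mat b a" "Z = L * Y" and YZ: "Y * Z = Y" and Zc: "Z \<in> carrier_mat b b"
    using Z by (auto simp: oproj_def a_def b_def)
  define V where "V = R * L * C"
  have V: "V \<in> carrier_mat r r" using C(1-3) L(1) unfolding V_def by (intro mult_carrier_mat[of _ r b] mult_carrier_mat[of _ r a])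
  have CV: "C * V = C"
  proof -
    have "C * V = C * R * L * C" unfolding V_def using C(1-3) L(1)
      by (simp add: assoc_mult_mat[of _ a r _ b _ a] assoc_mult_mat[of _ a r _ r _ r] assoc_mult_mat[of _ r b _ a _ r]
        assoc_mult_mat[of _ a b _ a _ r] assoc_mult_mat[of _ a r _ b _ r] assoc_mult_mat[of _ a r _ a _ r])
    \<comment> \<open>\<open>C = Y * U\<close> brings in a second \<open>Y\<close>, so that
      \<open>Y * Z = Y\<close> applies.\<close>
    also have "\<dots> = Y * L * (Y * U)" by (simp only: C(4)[symmetric] C(5)[symmetric])
    also have "\<dots> = Y * (L * Y) * U" using Y L(1) C(3)
      by (simp add: assoc_mult_mat[of _ a b _ a _ r] assoc_mult_mat[of _ a b _ a _ b] assoc_mult_mat[of _ b a _ b _ r]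
         assoc_mult_mat[of _ a b _ b _ r])
    also have "\<dots> = C" by (simp only: L(2)[symmetric] YZ C(5)[symmetric])
    finally show ?thesis .
  qed
  have V1: "V = 1\<^sub>m r"
  proof (rule mat_col_eqI)
    fix j assume j: "j < dim_col (1\<^sub>m r)"
    have cV: "col V j \<in> carrier_vec r" using V by auto
    have "C *\<^sub>v (col V j - col (1\<^sub>m r) j) = C *\<^sub>v col V j - C *\<^sub>v col (1\<^sub>m r) j"
      using C(1) cV j by (intro mult_minus_distrib_mat_vec) auto
    also have "C *\<^sub>v col V j = col C j"
      using col_mult2[OF C(1) V, of j] j CV by simp
    also have "C *\<^sub>v col (1\<^sub>m r) j = col C j"
      using col_mult2[OF C(1) one_carrier_mat, of j] j C(1) by simp
    finally have "col V j - col (1\<^sub>m r) j = 0\<^sub>v r"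
      using inj[of "col V j - col (1\<^sub>m r) j"] cV j C(1) by auto
    then have z: "(col V j - col (1\<^sub>m r) j) $ i = 0" if "i < r" for i using that by simp
    show "col V j = col (1\<^sub>m r) j"
    proof (rule eq_vecI)
      fix i assume "i < dim_vec (col (1\<^sub>m r) j)"
      then show "col V j $ i = col (1\<^sub>m r) j $ i" using z[of i] V j by simp
    qed (use V in simp)
  qed (use V in auto)
  have "mtrace Z = mtrace (L * C * R)"
    unfolding L(2) using C(1-3) L(1) by (simp add: C(4))
  also have "\<dots> = mtrace (R * (L * C))" using C(1-3) L(1) by (intro mtrace_comm[of _ b r]) auto
  also have "R * (L * C) = V" unfolding V_def using C(1-3) L(1) by simp
  finally show ?thesis by (simp add: V1 mtrace_one r_def)
qed

section \<open>Spectrum of self-adjoint matrices\<close>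

text \<open>Symmetry of \<open>G * E\<close> makes all complex eigenvalues real, and Schur
  triangulation writes the trace as their sum with multiplicity, each at least the minimum. Working
  with the form of \<open>G\<close> directly avoids its square root.\<close>

lemma self_adjoint_spectrum:
  fixes E :: "real mat"
  assumes G: "sym_pos_def n G" and E: "E \<in> carrier_mat n n" and n: "n > 0"
    and sym: "transpose_mat (G * E) = G * E"
  shows "spectrum E \<noteq> {}" "real n * Min (spectrum E) \<le> mtrace E"
proof -
  have Gc: "G \<in> carrier_mat n n" and Gt: "transpose_mat G = G" using G by (auto simp: sym_pos_def_def)
  have symm: "scalar_prod x (H *\<^sub>v y) = scalar_prod y (H *\<^sub>v x)"
    if "H \<in> carrier_mat n n" "transpose_mat H = H" "x \<in> carrier_vec n" "y \<in> carrier_vec n" for H and x y :: "real vec"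
  proof -
    have "scalar_prod x (H *\<^sub>v y) = scalar_prod (H *\<^sub>v x) y"
      using transpose_vec_mult_scalar[OF that(1) that(4,3)] that by simp
    then show ?thesis using that comm_scalar_prod[of "H *\<^sub>v x" n y] by simp
  qed
  define EC where "EC = map_mat complex_of_real E"
  have EC: "EC \<in> carrier_mat n n" using E by (simp add: EC_def)
  have real_ev: "Re e \<in> spectrum E" if "eigenvalue EC e" for e
  proof -
    obtain v where v: "v \<in> carrier_vec n" "v \<noteq> 0\<^sub>v n" "EC *\<^sub>v v = e \<cdot>\<^sub>v v"
      using \<open>eigenvalue EC e\<close> EC by (auto simp: eigenvalue_def eigenvector_def)
    define x y where "x = map_vec Re v" and "y = map_vec Im v"
    have xy: "x \<in> carrier_vec n" "y \<in> carrier_vec n" using v by (auto simp: x_def y_def)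
    define a b where "a = Re e" and "b = Im e"
    have ev: "(\<Sum>j<n. complex_of_real (E $$ (i,j)) * v $ j) = e * v $ i" if "i < n" for i
    proof -
      have "(EC *\<^sub>v v) $ i = (\<Sum>j<n. complex_of_real (E $$ (i,j)) * v $ j)"
        using that E v(1) by (simp add: EC_def scalar_prod_def lessThan_atLeast0)
      then show ?thesis using that v by simp
    qed
    \<comment> \<open>The eigenvalue equation is split into its real and imaginary parts.\<close>
    have Ex: "E *\<^sub>v x = a \<cdot>\<^sub>v x - b \<cdot>\<^sub>v y"
    proof (rule eq_vecI)
      fix i assume "i < dim_vec (a \<cdot>\<^sub>v x - b \<cdot>\<^sub>v y)"
      then have i: "i < n" using xy by simp
      have "(E *\<^sub>v x) $ i = Re (\<Sum>j<n. complex_of_real (E $$ (i,j)) * v $ j)"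
        using i E v(1) by (simp add: x_def scalar_prod_def lessThan_atLeast0)
      then show "(E *\<^sub>v x) $ i = (a \<cdot>\<^sub>v x - b \<cdot>\<^sub>v y) $ i"
        using i v(1) by (simp add: ev x_def y_def a_def b_def)
    qed (use E xy in auto)
    have Ey: "E *\<^sub>v y = b \<cdot>\<^sub>v x + a \<cdot>\<^sub>v y"
    proof (rule eq_vecI)
      fix i assume "i < dim_vec (b \<cdot>\<^sub>v x + a \<cdot>\<^sub>v y)"
      then have i: "i < n" using xy by simp
      have "(E *\<^sub>v y) $ i = Im (\<Sum>j<n. complex_of_real (E $$ (i,j)) * v $ j)"
        using i E v(1) by (simp add: y_def scalar_prod_def lessThan_atLeast0)
      then show "(E *\<^sub>v y) $ i = (b \<cdot>\<^sub>v x + a \<cdot>\<^sub>v y) $ i"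
        using i v(1) by (simp add: ev x_def y_def a_def b_def)
    qed (use E xy in auto)
    define g where "g u w = scalar_prod u (G *\<^sub>v w)" for u w
    \<comment> \<open>Symmetry of \<open>G * E\<close> and of \<open>G\<close> equates the two mixed
      products; the terms with \<open>a\<close> cancel and \<open>b * (g x x + g y y) = 0\<close>
      remains.\<close>
    have "scalar_prod y ((G * E) *\<^sub>v x) = a * g y x - b * g y y"
      using Gc E xy by (simp add: Ex g_def mult_minus_distrib_mat_vec[of _ n n] mult_mat_vec[of _ n n]
          scalar_prod_minus_distrib[of _ n])
    moreover have "scalar_prod x ((G * E) *\<^sub>v y) = b * g x x + a * g x y"
      using Gc E xy by (simp add: Ey g_def mult_add_distrib_mat_vec[of _ n n] mult_mat_vec[of _ n n]
          scalar_prod_add_distrib[of _ n])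
    moreover have "scalar_prod x ((G * E) *\<^sub>v y) = scalar_prod y ((G * E) *\<^sub>v x)"
      using symm[of "G * E" x y] Gc E xy sym by simp
    moreover have "g x y = g y x" using symm[OF Gc Gt xy] by (simp add: g_def)
    ultimately have b0: "b * (g x x + g y y) = 0" by (simp add: algebra_simps)
    have nn: "g u u \<ge> 0" "u \<noteq> 0\<^sub>v n \<Longrightarrow> g u u > 0" if "u \<in> carrier_vec n" for u
      using G that Gc unfolding sym_pos_def_def g_def by (cases "u = 0\<^sub>v n", auto intro: less_imp_le)
    have ne: "x \<noteq> 0\<^sub>v n \<or> y \<noteq> 0\<^sub>v n"
    proof (rule ccontr)
      assume "\<not> ?thesis"
      then have z: "x = 0\<^sub>v n" "y = 0\<^sub>v n" by auto
      have "v $ i = 0" if "i < n" for i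
        using arg_cong[OF z(1), of "\<lambda>u. u $ i"] arg_cong[OF z(2), of "\<lambda>u. u $ i"] that v(1)
        by (simp add: x_def y_def complex_eq_iff)
      then have "v = 0\<^sub>v n" using v(1) by (intro eq_vecI) auto
      with v show False by simp
    qed
    then have "g x x + g y y > 0" using nn xy by (metis add_nonneg_pos add_pos_nonneg)
    then have "b = 0" using b0 by simp
    \<comment> \<open>Both parts now satisfy the real equation, and whichever is nonzero is an
      eigenvector of \<open>E\<close>.\<close>
    then have "E *\<^sub>v x = a \<cdot>\<^sub>v x" "E *\<^sub>v y = a \<cdot>\<^sub>v y" using Ex Ey xy by auto
    then have "eigenvalue E a" unfolding eigenvalue_def eigenvector_def using ne xy E by auto
    then show ?thesis by (simp add: spectrum_def a_def)
  qed
  from spectrum_non_empty[OF EC n] real_ev show "spectrum E \<noteq> {}" by (auto simp: spectrum_def)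
  obtain es where es: "char_poly EC = (\<Prod>a\<leftarrow>es. [:- a, 1:])" using char_poly_factorized[OF EC] by blast
  obtain B where B: "B \<in> carrier_mat n n" "upper_triangular B" "similar_mat EC B"
    using schur_decomposition_exists[OF EC es] by blast
  obtain P Q where PQ: "similar_mat_wit EC B P Q" using B(3) by (auto simp: similar_mat_def)
  note w = similar_mat_witD2[OF EC PQ]
  have "mtrace EC = mtrace (Q * (P * B))"
    unfolding w(3) using w(5-7) by (intro mtrace_comm[of _ n n]) auto
  also have "Q * (P * B) = Q * P * B" using w(5-7) by simp
  finally have tr: "mtrace EC = mtrace B" using w(2) B(1) by simp
  \<comment> \<open>Diagonal entries of the triangular \<open>B\<close> are roots of its
    characteristic polynomial, which \<open>EC\<close> shares.\<close>
  have diag: "Re (B $$ (i,i)) \<in> spectrum E" if "i < n" for i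
  proof (rule real_ev)
    have "B $$ (i,i) \<in> set (diag_mat B)" using that B(1) by (auto simp: diag_mat_def)
    then have "poly (char_poly B) (B $$ (i,i)) = 0"
      by (simp add: char_poly_upper_triangular[OF B(1,2)] poly_prod_list prod_list_zero_iff image_iff)
    then show "eigenvalue EC (B $$ (i,i))"
      by (simp add: eigenvalue_root_char_poly[OF EC] char_poly_similar[OF B(3)])
  qed
  have "mtrace E = Re (mtrace EC)" using E by (simp add: mtrace_def EC_def)
  also have "\<dots> = (\<Sum>i<n. Re (B $$ (i,i)))" unfolding tr using B(1) by (simp add: mtrace_def)
  also have "\<dots> \<ge> (\<Sum>i<n. Min (spectrum E))"
    by (intro sum_mono Min_le card_finite_spectrum[OF E] diag) auto
  finally show "real n * Min (spectrum E) \<le> mtrace E" by simp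
qed

text \<open>At an eigenvector \<open>v\<close>, the form of \<open>G * E\<close> is \<open>a\<close>
  times the positive form of \<open>G\<close>.\<close>

lemma spectrum_nonneg:
  fixes E :: "real mat"
  assumes G: "sym_pos_def n G" and E: "E \<in> carrier_mat n n"
    and psd: "\<And>v. v \<in> carrier_vec n \<Longrightarrow> scalar_prod v ((G * E) *\<^sub>v v) \<ge> 0"
    and a: "a \<in> spectrum E"
  shows "a \<ge> 0"
proof -
  obtain v where v: "v \<in> carrier_vec n" "v \<noteq> 0\<^sub>v n" "E *\<^sub>v v = a \<cdot>\<^sub>v v"
    using a E by (auto simp: spectrum_def eigenvalue_def eigenvector_def)
  have Gc: "G \<in> carrier_mat n n" using G by (simp add: sym_pos_def_def)
  have "scalar_prod v ((G * E) *\<^sub>v v) = a * scalar_prod v (G *\<^sub>v v)"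
    using v Gc E by (simp add: mult_mat_vec[of _ n n])
  moreover have "scalar_prod v (G *\<^sub>v v) > 0" using G v by (simp add: sym_pos_def_def)
  ultimately show ?thesis using psd[OF v(1)] by (simp add: zero_le_mult_iff)
qed

section \<open>Boundedness and measurability\<close>

lemma oproj_idem: "oproj G Y Q \<Longrightarrow> Q * Q = Q"
  by (rule oproj_absorb)

text \<open>Pythagoras: by idempotence and self-adjointness, the forms of \<open>G * Q\<close> and
  \<open>G - G * Q\<close> at \<open>v\<close> are the nonnegative forms of \<open>G\<close> at
  \<open>Q *\<^sub>v v\<close> and \<open>(1\<^sub>m m - Q) *\<^sub>v v\<close>.\<close>

lemma oproj_psd:
  assumes G: "sym_pos_def m G" and Y: "dim_col Y = m" and Q: "oproj G Y Q" and v: "v \<in> carrier_vec m"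
  shows "0 \<le> scalar_prod v ((G * Q) *\<^sub>v v)" "scalar_prod v ((G * Q) *\<^sub>v v) \<le> scalar_prod v (G *\<^sub>v v)"
proof -
  have c: "G \<in> carrier_mat m m" "Q \<in> carrier_mat m m" and Gt: "transpose_mat G = G"
    using G Y Q by (auto simp: sym_pos_def_def oproj_def)
  have QtG: "transpose_mat Q * G = G * Q"
    using Q c Gt by (auto simp: oproj_def transpose_mult[of _ m m _ m])
  have nn: "scalar_prod u (G *\<^sub>v u) \<ge> 0" if "u \<in> carrier_vec m" for u
    using G c that unfolding sym_pos_def_def by (cases "u = 0\<^sub>v m") (auto intro: less_imp_le)
  have form: "scalar_prod (X *\<^sub>v v) (G *\<^sub>v (X *\<^sub>v v)) = scalar_prod v ((transpose_mat X * G * X) *\<^sub>v v)"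
    if X: "X \<in> carrier_mat m m" for X
  proof -
    have "scalar_prod (X *\<^sub>v v) (G *\<^sub>v (X *\<^sub>v v)) = scalar_prod (G *\<^sub>v (X *\<^sub>v v)) (X *\<^sub>v v)"
      using X c v by (intro comm_scalar_prod[of _ m]) auto
    also have "\<dots> = scalar_prod (transpose_mat X *\<^sub>v (G *\<^sub>v (X *\<^sub>v v))) v"
      using transpose_vec_mult_scalar[OF X v, of "G *\<^sub>v (X *\<^sub>v v)"] X c v by simp
    also have "\<dots> = scalar_prod v (transpose_mat X *\<^sub>v (G *\<^sub>v (X *\<^sub>v v)))"
      using X c v by (intro comm_scalar_prod[of _ m]) auto
    finally show ?thesis using X c v by (simp add: assoc_mult_mat_vec[of _ m m _ m])
  qed
  have "transpose_mat Q * G * Q = G * Q"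
    using c oproj_idem[OF Q] by (simp add: QtG)
  then show "0 \<le> scalar_prod v ((G * Q) *\<^sub>v v)"
    using nn[of "Q *\<^sub>v v"] form[OF c(2)] c v by simp
  define X where "X = 1\<^sub>m m - Q"
  have X: "X \<in> carrier_mat m m" using c by (simp add: X_def minus_carrier_mat)
  have GX: "G * X = G - G * Q" using c by (simp add: X_def mult_minus_distrib_mat[of _ m m _ m])
  have QX: "Q * X = 0\<^sub>m m m" using c oproj_idem[OF Q] by (simp add: X_def mult_minus_distrib_mat[of _ m m _ m])
  have "transpose_mat X * G = G - G * Q"
    using c QtG by (simp add: X_def transpose_minus[of _ m m] minus_mult_distrib_mat[of _ m m _ _ m])
  then have "transpose_mat X * G * X = G * X - G * (Q * X)"
    using c X by (simp add: minus_mult_distrib_mat[of _ m m _ _ m] assoc_mult_mat[of _ m m _ m _ m])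
  also have "\<dots> = G - G * Q" unfolding QX using c by (simp add: GX) (intro eq_matI, auto)
  finally have "scalar_prod (X *\<^sub>v v) (G *\<^sub>v (X *\<^sub>v v)) = scalar_prod v (G *\<^sub>v v) - scalar_prod v ((G * Q) *\<^sub>v v)"
    using form[OF X] c v by (simp add: minus_mult_distrib_mat_vec[of _ m m] scalar_prod_minus_distrib[of _ m])
  then show "scalar_prod v ((G * Q) *\<^sub>v v) \<le> scalar_prod v (G *\<^sub>v v)"
    using nn[of "X *\<^sub>v v"] X v by simp
qed

lemma scalar_prod_mat_vec_sum:
  assumes "H \<in> carrier_mat n n" "v \<in> carrier_vec n"
  shows "scalar_prod v (H *\<^sub>v v) = (\<Sum>i<n. \<Sum>j<n. v $ i * H $$ (i,j) * (v $ j :: real))"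
  using assms by (simp add: scalar_prod_def lessThan_atLeast0 sum_distrib_left mult.assoc)

text \<open>Evaluate the form at \<open>unit_vec n i + s \<cdot>\<^sub>v unit_vec n j\<close> for
  \<open>s\<close> equal to 0, 1 and -1.\<close>

lemma psd_entry_bound:
  fixes H :: "real mat"
  assumes H: "H \<in> carrier_mat n n" "transpose_mat H = H"
    and psd: "\<And>v. v \<in> carrier_vec n \<Longrightarrow> 0 \<le> scalar_prod v (H *\<^sub>v v)"
    and ij: "i < n" "j < n"
  shows "0 \<le> H $$ (i,i)" "2 * \<bar>H $$ (i,j)\<bar> \<le> H $$ (i,i) + H $$ (j,j)"
proof -
  have sym: "H $$ (j,i) = H $$ (i,j)" using H ij by (metis carrier_matD index_transpose_mat(1))
  have form: "scalar_prod v (H *\<^sub>v v) = H $$ (i,i) + 2 * s * H $$ (i,j) + s * s * H $$ (j,j)"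
    if v: "v = unit_vec n i + s \<cdot>\<^sub>v unit_vec n j" for v s
  proof -
    have ue: "H *\<^sub>v unit_vec n k = col H k" if "k < n" for k
      using that H by (intro eq_vecI) auto
    have "H *\<^sub>v v = col H i + s \<cdot>\<^sub>v col H j"
      unfolding v using H ij by (simp add: mult_add_distrib_mat_vec[of _ n n] mult_mat_vec[of _ n n] ue)
    then show ?thesis unfolding v using H ij sym
      by (simp add: add_scalar_prod_distrib[of _ n] algebra_simps)
  qed
  show d: "0 \<le> H $$ (i,i)" using psd[of "unit_vec n i + 0 \<cdot>\<^sub>v unit_vec n j"] form[OF refl, of 0] by simp
  show "2 * \<bar>H $$ (i,j)\<bar> \<le> H $$ (i,i) + H $$ (j,j)"
    using psd[of "unit_vec n i + 1 \<cdot>\<^sub>v unit_vec n j"] form[OF refl, of 1]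
      psd[of "unit_vec n i + (-1) \<cdot>\<^sub>v unit_vec n j"] form[OF refl, of "-1"] by (simp add: abs_if)
qed

text \<open>\<open>G * Q\<close> lies between 0 and \<open>G\<close>, so its entries are bounded by
  the trace \<open>g\<close> of \<open>G\<close>; multiplying by the inverse \<open>K\<close> bounds
  \<open>Q\<close>. The constant is uniform in \<open>Y\<close> and its number of rows, which makes
  random projections integrable.\<close>

lemma oproj_bounded:
  assumes G: "sym_pos_def m G"
  shows "\<exists>c. \<forall>Y Q. dim_col Y = m \<longrightarrow> oproj G Y Q \<longrightarrow> (\<forall>i<m. \<forall>j<m. \<bar>Q $$ (i,j)\<bar> \<le> c)"
proof -
  obtain K where K: "K * G = 1\<^sub>m m" "sym_pos_def m K" using sym_pos_def_inverse[OF G] by metis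
  have Kc: "K \<in> carrier_mat m m" and Gc: "G \<in> carrier_mat m m" using K G by (auto simp: sym_pos_def_def)
  define g where "g = (\<Sum>k<m. G $$ (k,k))"
  have "\<bar>Q $$ (i,j)\<bar> \<le> (\<Sum>i<m. \<Sum>k<m. \<bar>K $$ (i,k)\<bar>) * g"
    if Y: "dim_col Y = m" and Q: "oproj G Y Q" and ij: "i < m" "j < m" for Y Q i j
  proof -
    define H where "H = G * Q"
    have Qc: "Q \<in> carrier_mat m m" using Q Y by (simp add: oproj_def)
    have H: "H \<in> carrier_mat m m" "transpose_mat H = H" using Q Gc Qc by (auto simp: oproj_def H_def)
    have psd: "v \<in> carrier_vec m \<Longrightarrow> 0 \<le> scalar_prod v (H *\<^sub>v v)" for v
      using oproj_psd(1)[OF G Y Q] by (simp add: H_def)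
    have diag: "H $$ (k,k) \<le> G $$ (k,k)" if "k < m" for k
    proof -
      have "scalar_prod (unit_vec m k) (X *\<^sub>v unit_vec m k) = X $$ (k,k)" if "X \<in> carrier_mat m m" for X :: "real mat"
        using that \<open>k < m\<close> by simp
      then show ?thesis using oproj_psd(2)[OF G Y Q, of "unit_vec m k"] H(1) Gc by (simp add: H_def)
    qed
    have Gnn: "0 \<le> G $$ (k,k)" if "k < m" for k
      using psd_entry_bound(1)[OF H psd that that] diag[OF that] by simp
    have Gg: "G $$ (k,k) \<le> g" if "k < m" for k
      unfolding g_def by (rule member_le_sum) (use that Gnn in auto)
    have Hb: "\<bar>H $$ (k,l)\<bar> \<le> g" if "k < m" "l < m" for k l
      using psd_entry_bound(2)[OF H psd that] diag[OF that(1)] diag[OF that(2)] Gg[OF that(1)] Gg[OF that(2)] by simp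
    have "Q = K * H" using Kc Gc Qc K(1) unfolding H_def by (simp flip: assoc_mult_mat[of K m m G m Q m] del: assoc_mult_mat)
    then have "Q $$ (i,j) = (\<Sum>k<m. K $$ (i,k) * H $$ (k,j))"
      using Kc H(1) ij by (simp add: scalar_prod_def lessThan_atLeast0)
    also have "\<bar>\<dots>\<bar> \<le> (\<Sum>k<m. \<bar>K $$ (i,k)\<bar> * g)"
      by (rule order_trans[OF sum_abs]) (auto simp: abs_mult intro!: sum_mono mult_left_mono Hb ij)
    also have "\<dots> = (\<Sum>k<m. \<bar>K $$ (i,k)\<bar>) * g" by (simp add: sum_distrib_right)
    also have "\<dots> \<le> (\<Sum>i<m. \<Sum>k<m. \<bar>K $$ (i,k)\<bar>) * g"
      using ij Gnn by (intro mult_right_mono member_le_sum) (auto simp: g_def intro!: sum_nonneg)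
    finally show ?thesis .
  qed
  then show ?thesis by blast
qed

text \<open>The dimensions are fixed for every \<open>w\<close>, also outside
  \<open>space M\<close>, so that formulas for entries are equations between functions.\<close>

definition mat_measurable :: "'w measure \<Rightarrow> nat \<Rightarrow> nat \<Rightarrow> ('w \<Rightarrow> real mat) \<Rightarrow> bool" where
  "mat_measurable M a b X \<longleftrightarrow> (\<forall>w. X w \<in> carrier_mat a b) \<and>
     (\<forall>i<a. \<forall>j<b. (\<lambda>w. X w $$ (i,j)) \<in> borel_measurable M)"

lemma mat_measurableI:
  assumes "\<And>w. X w \<in> carrier_mat a b"
    "\<And>i j. i < a \<Longrightarrow> j < b \<Longrightarrow> (\<lambda>w. X w $$ (i,j)) \<in> borel_measurable M"
  shows "mat_measurable M a b X"
  using assms by (simp add: mat_measurable_def)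

lemma mat_measurableD:
  assumes "mat_measurable M a b X"
  shows "X w \<in> carrier_mat a b" "dim_row (X w) = a" "dim_col (X w) = b"
    "i < a \<Longrightarrow> j < b \<Longrightarrow> (\<lambda>w. X w $$ (i,j)) \<in> borel_measurable M"
  using assms carrier_matD[of "X w" a b] by (simp_all add: mat_measurable_def)

lemma mat_measurable_const: "X \<in> carrier_mat a b \<Longrightarrow> mat_measurable M a b (\<lambda>_. X)"
  by (simp add: mat_measurable_def)

lemma mat_measurable_transpose:
  "mat_measurable M a b X \<Longrightarrow> mat_measurable M b a (\<lambda>w. transpose_mat (X w))"
  using mat_measurableD[of M a b X] by (intro mat_measurableI) auto

lemma mat_measurable_add:
  "mat_measurable M a b X \<Longrightarrow> mat_measurable M a b Y \<Longrightarrow> mat_measurable M a b (\<lambda>w. X w + Y w)"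
  using mat_measurableD[of M a b X] mat_measurableD[of M a b Y] by (intro mat_measurableI) auto

lemma mat_measurable_diff:
  "mat_measurable M a b X \<Longrightarrow> mat_measurable M a b Y \<Longrightarrow> mat_measurable M a b (\<lambda>w. X w - Y w)"
  using mat_measurableD[of M a b X] mat_measurableD[of M a b Y] by (intro mat_measurableI) (auto simp: minus_carrier_mat)

lemma mat_measurable_smult:
  "f \<in> borel_measurable M \<Longrightarrow> mat_measurable M a b X \<Longrightarrow> mat_measurable M a b (\<lambda>w. f w \<cdot>\<^sub>m X w)"
  using mat_measurableD[of M a b X] by (intro mat_measurableI) auto

lemma mat_measurable_mult:
  assumes X: "mat_measurable M a b X" and Y: "mat_measurable M b c Y"
  shows "mat_measurable M a c (\<lambda>w. X w * Y w)"
proof (rule mat_measurableI)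
  fix i j assume ij: "i < a" "j < c"
  have "(\<lambda>w. (X w * Y w) $$ (i,j)) = (\<lambda>w. \<Sum>k<b. X w $$ (i,k) * Y w $$ (k,j))"
    using ij mat_measurableD(2,3)[OF X] mat_measurableD(2,3)[OF Y]
    by (auto simp: scalar_prod_def lessThan_atLeast0)
  also have "\<dots> \<in> borel_measurable M"
    using ij mat_measurableD(4)[OF X] mat_measurableD(4)[OF Y]
    by (intro borel_measurable_sum borel_measurable_times) auto
  finally show "(\<lambda>w. (X w * Y w) $$ (i,j)) \<in> borel_measurable M" .
qed (use mat_measurableD(1)[OF X] mat_measurableD(1)[OF Y] mult_carrier_mat in blast)

text \<open>Each step uses sums, products and one division. The convention \<open>1 / 0 = 0\<close>
  keeps \<open>1 / s\<close> measurable where a row depends on earlier ones.\<close>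

lemma mat_measurable_gram_proj:
  assumes K: "K \<in> carrier_mat m m" and y: "\<And>k. mat_measurable M m 1 (y k)"
  shows "mat_measurable M m m (\<lambda>w. gram_proj m K (\<lambda>k. y k w) k)"
proof (induction k)
  case 0
  show ?case by (simp add: mat_measurable_const)
next
  case (Suc k)
  let ?Q = "\<lambda>w. gram_proj m K (\<lambda>k. y k w) k"
  define r where "r w = (1\<^sub>m m - transpose_mat (?Q w)) * y k w" for w
  have "mat_measurable M m m (\<lambda>w. 1\<^sub>m m - transpose_mat (?Q w))"
    by (intro mat_measurable_diff mat_measurable_const mat_measurable_transpose Suc.IH one_carrier_mat)
  then have r: "mat_measurable M m 1 r" unfolding r_def by (rule mat_measurable_mult[OF _ y])
  define s where "s w = (transpose_mat (r w) * K * r w) $$ (0,0)" for w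
  have "mat_measurable M 1 1 (\<lambda>w. transpose_mat (r w) * K * r w)"
    by (intro mat_measurable_mult[of _ _ m] mat_measurable_const mat_measurable_transpose r K)
  from mat_measurableD(4)[OF this, of 0 0] have s: "s \<in> borel_measurable M" by (simp add: s_def[abs_def])
  have "mat_measurable M m m (\<lambda>w. ?Q w + (1 / s w) \<cdot>\<^sub>m (K * r w * transpose_mat (r w)))"
    by (intro mat_measurable_add mat_measurable_smult mat_measurable_mult[of _ _ 1] mat_measurable_mult[of _ _ m]
         mat_measurable_const mat_measurable_transpose Suc r K borel_measurable_divide s) auto
  then show ?case by (simp add: Let_def r_def s_def)
qed

text \<open>Uniqueness identifies \<open>F\<close> with the Gram-Schmidt projection. That is
  measurable for each fixed number of steps, and the number \<open>\<tau> w\<close> of steps takes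
  countably many values.\<close>

lemma oproj_random_measurable:
  assumes G: "sym_pos_def m G" and A: "A \<in> carrier_mat p m" and S: "random_mat M p \<tau> S"
    and F: "\<And>w. w \<in> space M \<Longrightarrow> oproj G (transpose_mat (S w) * A) (F w)"
    and ij: "i < m" "j < m"
  shows "(\<lambda>w. F w $$ (i,j)) \<in> borel_measurable M"
proof -
  obtain K where K: "G * K = 1\<^sub>m m" "K * G = 1\<^sub>m m" "sym_pos_def m K" using sym_pos_def_inverse[OF G] by metis
  have Kc: "K \<in> carrier_mat m m" using K by (simp add: sym_pos_def_def)
  \<comment> \<open>Row \<open>k\<close> of \<open>transpose_mat (S w) * A\<close> as a column,
    continued by zero for \<open>k \<ge> \<tau> w\<close> so that it is defined and measurable for
    all \<open>k\<close>.\<close>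
  define y where "y k w = mat m 1 (\<lambda>(j, _). \<Sum>i<p. A $$ (i,j) * (if k < \<tau> w then S w $$ (i,k) else 0))" for k w
  have Sm: "(\<lambda>w. if k < \<tau> w then S w $$ (i,k) else 0) \<in> borel_measurable M" if "i < p" for i k
    using S that by (auto simp: random_mat_def)
  have ym: "mat_measurable M m 1 (y k)" for k
  proof (rule mat_measurableI)
    fix i j assume "i < m" "j < (1::nat)"
    then have "(\<lambda>w. y k w $$ (i,j)) = (\<lambda>w. \<Sum>l<p. A $$ (l,i) * (if k < \<tau> w then S w $$ (l,k) else 0))"
      by (simp add: y_def)
    also have "\<dots> \<in> borel_measurable M"
      using Sm by (intro borel_measurable_sum borel_measurable_times) auto
    finally show "(\<lambda>w. y k w $$ (i,j)) \<in> borel_measurable M" .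
  qed (simp add: y_def)
  have "(\<lambda>w. gram_proj m K (\<lambda>k. y k w) (\<tau> w) $$ (i,j)) \<in> borel_measurable M"
    by (rule measurable_compose_countable[where f = "\<lambda>t w. gram_proj m K (\<lambda>k. y k w) t $$ (i,j)"])
      (use mat_measurableD(4)[OF mat_measurable_gram_proj[OF Kc ym] ij] S in \<open>auto simp: random_mat_def\<close>)
  moreover have "F w $$ (i,j) = gram_proj m K (\<lambda>k. y k w) (\<tau> w) $$ (i,j)" if w: "w \<in> space M" for w
  proof -
    have Sw: "S w \<in> carrier_mat p (\<tau> w)" using S w by (simp add: random_mat_def)
    have "oproj G (transpose_mat (S w) * A) (gram_proj m K (\<lambda>k. y k w) (\<tau> w))"
    proof (rule oproj_gram_proj[OF G K])
      show "transpose_mat (S w) * A \<in> carrier_mat (\<tau> w) m" using Sw A by simp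
      fix k assume k: "k < \<tau> w"
      show "y k w = transpose_mat (mat 1 m (\<lambda>(_, j). (transpose_mat (S w) * A) $$ (k,j)))"
        using Sw A k by (intro eq_matI) (auto simp: y_def scalar_prod_def lessThan_atLeast0 mult.commute)
    qed
    then show ?thesis using oproj_unique[OF G _ F[OF w]] A by simp
  qed
  ultimately show ?thesis by (simp cong: measurable_cong)
qed

section \<open>The expected projection\<close>

text \<open>Idempotence need not survive averaging, but symmetry and semidefiniteness of
  \<open>G * Z w\<close> and the trace formula do, by linearity and monotonicity of the expectation.
  The bounds on \<open>lambda_min E\<close> rest on these.\<close>

lemma (in prob_space) expect_mat_oproj:
  assumes G: "sym_pos_def n G" and n: "n > 0"
    and Y: "\<And>w. w \<in> space M \<Longrightarrow> dim_col (Y w) = n"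
    and Z: "\<And>w. w \<in> space M \<Longrightarrow> oproj G (Y w) (Z w)"
    and meas: "\<And>i j. i < n \<Longrightarrow> j < n \<Longrightarrow> (\<lambda>w. Z w $$ (i,j)) \<in> borel_measurable M"
  defines "E \<equiv> expect_mat M n n Z" and "Ed \<equiv> expectation (\<lambda>w. real (mat_rank (Y w)))"
  shows "Ed \<le> real n" "0 \<le> lambda_min E" "real n * lambda_min E \<le> Ed"
proof -
  have Gc: "G \<in> carrier_mat n n" using G by (simp add: sym_pos_def_def)
  obtain c where c: "\<And>Y Q i j. dim_col Y = n \<Longrightarrow> oproj G Y Q \<Longrightarrow> i < n \<Longrightarrow> j < n \<Longrightarrow> \<bar>Q $$ (i,j)\<bar> \<le> c"
    using oproj_bounded[OF G] by blast
  \<comment> \<open>The uniform bound on projections turns measurability of the entries into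
    integrability.\<close>
  have int: "integrable M (\<lambda>w. Z w $$ (i,j))" if "i < n" "j < n" for i j
    by (rule integrable_const_bound[of _ c]) (use c[OF Y Z that] meas that in auto)
  have Zc: "Z w \<in> carrier_mat n n" if "w \<in> space M" for w using Z[OF that] Y[OF that] by (simp add: oproj_def)
  have E: "E \<in> carrier_mat n n" by (simp add: E_def expect_mat_def)
  have Eij: "E $$ (i,j) = expectation (\<lambda>w. Z w $$ (i,j))" if "i < n" "j < n" for i j
    using that by (simp add: E_def expect_mat_def)
  have GZ: "(G * Z w) $$ (i,j) = (\<Sum>k<n. G $$ (i,k) * Z w $$ (k,j))"
    if "i < n" "j < n" "w \<in> space M" for i j w
    using that Gc Zc[OF that(3)] by (simp add: scalar_prod_def lessThan_atLeast0)
  have GZint: "integrable M (\<lambda>w. (G * Z w) $$ (i,j))" if "i < n" "j < n" for i j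
  proof -
    have "integrable M (\<lambda>w. \<Sum>k<n. G $$ (i,k) * Z w $$ (k,j))" using int that by auto
    then show ?thesis using GZ[OF that] by (simp cong: Bochner_Integration.integrable_cong)
  qed
  have GE: "(G * E) $$ (i,j) = expectation (\<lambda>w. (G * Z w) $$ (i,j))" if "i < n" "j < n" for i j
  proof -
    have "(G * E) $$ (i,j) = (\<Sum>k<n. G $$ (i,k) * expectation (\<lambda>w. Z w $$ (k,j)))"
      using that Gc E Eij by (simp add: scalar_prod_def lessThan_atLeast0)
    also have "\<dots> = expectation (\<lambda>w. \<Sum>k<n. G $$ (i,k) * Z w $$ (k,j))"
      using int that by (subst Bochner_Integration.integral_sum) auto
    also have "\<dots> = expectation (\<lambda>w. (G * Z w) $$ (i,j))"
      by (rule Bochner_Integration.integral_cong) (use GZ that in auto)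
    finally show ?thesis .
  qed
  have sym: "transpose_mat (G * E) = G * E"
  proof (rule eq_matI)
    fix i j assume "i < dim_row (G * E)" "j < dim_col (G * E)"
    then have ij: "i < n" "j < n" using Gc E by auto
    have "(G * Z w) $$ (j,i) = (G * Z w) $$ (i,j)" if w: "w \<in> space M" for w
    proof -
      have "transpose_mat (G * Z w) $$ (i,j) = (G * Z w) $$ (i,j)" using Z[OF w] by (simp add: oproj_def)
      then show ?thesis using ij Gc Zc[OF w] by simp
    qed
    then have "(G * E) $$ (j,i) = (G * E) $$ (i,j)"
      unfolding GE[OF ij] GE[OF ij(2,1)] by (intro Bochner_Integration.integral_cong) auto
    then show "transpose_mat (G * E) $$ (i,j) = (G * E) $$ (i,j)" using ij Gc E by simp
  qed (use Gc E in auto)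
  have psd: "0 \<le> scalar_prod v ((G * E) *\<^sub>v v)" if v: "v \<in> carrier_vec n" for v
  proof -
    have "scalar_prod v ((G * E) *\<^sub>v v) = (\<Sum>i<n. \<Sum>j<n. v $ i * (G * E) $$ (i,j) * v $ j)"
      using v Gc E by (intro scalar_prod_mat_vec_sum) auto
    also have "\<dots> = (\<Sum>i<n. \<Sum>j<n. expectation (\<lambda>w. v $ i * (G * Z w) $$ (i,j) * v $ j))"
      by (intro sum.cong refl) (simp add: GE)
    also have "\<dots> = (\<Sum>i<n. expectation (\<lambda>w. \<Sum>j<n. v $ i * (G * Z w) $$ (i,j) * v $ j))"
      using GZint by (intro sum.cong refl Bochner_Integration.integral_sum[symmetric]) auto
    also have "\<dots> = expectation (\<lambda>w. \<Sum>i<n. \<Sum>j<n. v $ i * (G * Z w) $$ (i,j) * v $ j)"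
      using GZint by (intro Bochner_Integration.integral_sum[symmetric]) auto
    also have "\<dots> = expectation (\<lambda>w. scalar_prod v ((G * Z w) *\<^sub>v v))"
      using v Gc Zc by (intro Bochner_Integration.integral_cong refl scalar_prod_mat_vec_sum[symmetric]) auto
    also have "\<dots> \<ge> 0"
      using oproj_psd(1)[OF G Y Z v] by (intro Bochner_Integration.integral_nonneg) auto
    finally show ?thesis .
  qed
  have tr: "mtrace (Z w) = real (mat_rank (Y w))" if "w \<in> space M" for w
    using mtrace_oproj[OF Z[OF that]] .
  have "mtrace E = (\<Sum>i<n. expectation (\<lambda>w. Z w $$ (i,i)))" using E Eij by (simp add: mtrace_def)
  also have "\<dots> = expectation (\<lambda>w. \<Sum>i<n. Z w $$ (i,i))"
    using int by (intro Bochner_Integration.integral_sum[symmetric]) auto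
  also have "\<dots> = Ed" unfolding Ed_def
    using tr Zc by (intro Bochner_Integration.integral_cong refl) (auto simp: mtrace_def)
  finally have trE: "mtrace E = Ed" .
  \<comment> \<open>The rank equals the trace of \<open>Z w\<close> on \<open>space M\<close>, which
    makes it measurable and integrable.\<close>
  have "integrable M (\<lambda>w. \<Sum>i<n. Z w $$ (i,i))" using int by auto
  then have dint: "integrable M (\<lambda>w. real (mat_rank (Y w)))"
    by (rule Bochner_Integration.integrable_cong[THEN iffD1, rotated -1]) (use tr Zc in \<open>auto simp: mtrace_def\<close>)
  have "mat_rank (Y w) \<le> n" if "w \<in> space M" for w
    unfolding mat_rank_def by (rule vec_space.rank_le_nc) (use Y[OF that] in \<open>auto intro: carrier_matI\<close>)
  then show "Ed \<le> real n" unfolding Ed_def by (intro integral_le_const dint) auto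
  note spec = self_adjoint_spectrum[OF G E n sym]
  \<comment> \<open>The spectrum is finite and nonempty, so \<open>Min\<close> is attained.\<close>
  have "lambda_min E \<in> spectrum E" unfolding lambda_min_def
    using spec(1) card_finite_spectrum(1)[OF E] by (rule Min_in[rotated])
  then show "0 \<le> lambda_min E" using spectrum_nonneg[OF G E] psd by blast
  show "real n * lambda_min E \<le> Ed" using spec(2) trE by (simp add: lambda_min_def)
qed

section \<open>The Kronecker product of the two random projections\<close>

theorem theorem4p3:
  fixes M :: "'w measure"
    and m n p q :: nat
    and A B G :: "real mat"
    and \<tau>\<^sub>1 \<tau>\<^sub>2 :: "'w \<Rightarrow> nat"
    and S P :: "'w \<Rightarrow> real mat"
  assumes "prob_space M"
    and "m > 0" and "n > 0"
    and "A \<in> carrier_mat p m"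
    and "B \<in> carrier_mat n q"
    and "sym_pos_def m G"
    and "random_mat M p \<tau>\<^sub>1 S"
    and "random_mat M q \<tau>\<^sub>2 P"
  shows "let d = (\<lambda>w. mat_rank (kron (transpose_mat (P w) * transpose_mat B)
                                      (transpose_mat (S w) * A)));
             Ed = integral\<^sup>L M (\<lambda>w. real (d w));
             \<rho> = 1 - lambda_min (expect_mat M (n * m) (n * m) (\<lambda>w. kron (Z2 B (P w)) (Z1 A G (S w))))
         in 0 \<le> 1 - Ed / (real m * real n) \<and>
            1 - Ed / (real m * real n) \<le> \<rho> \<and>
            \<rho> \<le> 1"
proof -
  interpret prob_space M by fact
  note A = \<open>A \<in> carrier_mat p m\<close> and B = \<open>B \<in> carrier_mat n q\<close> and G = \<open>sym_pos_def m G\<close>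
    and S = \<open>random_mat M p \<tau>\<^sub>1 S\<close> and P = \<open>random_mat M q \<tau>\<^sub>2 P\<close>
  have Bt: "transpose_mat B \<in> carrier_mat q n" using B by simp
  define Y where "Y w = kron (transpose_mat (P w) * transpose_mat B) (transpose_mat (S w) * A)" for w
  define Z where "Z w = kron (Z2 B (P w)) (Z1 A G (S w))" for w
  have Q1: "oproj G (transpose_mat (S w) * A) (Z1 A G (S w))" if "w \<in> space M" for w
    using S that by (intro oproj_Z1[OF G A, of _ "\<tau>\<^sub>1 w"]) (simp add: random_mat_def)
  have Q2: "oproj (1\<^sub>m n) (transpose_mat (P w) * transpose_mat B) (Z2 B (P w))" if "w \<in> space M" for w
    using P that by (intro oproj_Z2[OF B, of _ "\<tau>\<^sub>2 w"]) (simp add: random_mat_def)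
  have Gc: "G \<in> carrier_mat m m" using G by (simp add: sym_pos_def_def)
  have Z: "oproj (kron (1\<^sub>m n) G) (Y w) (Z w)" if "w \<in> space M" for w
    unfolding Y_def Z_def using A B Gc Q1[OF that] Q2[OF that] by (intro oproj_kron[of _ n _ m]) auto
  have Y: "dim_col (Y w) = n * m" for w using A B by (simp add: Y_def)
  have meas: "(\<lambda>w. Z w $$ (i,j)) \<in> borel_measurable M" if ij: "i < n * m" "j < n * m" for i j
  proof -
    note ij' = div_mod_less[OF ij(1)] div_mod_less[OF ij(2)]
    \<comment> \<open>Entries of a Kronecker product are products of entries, so measurability
      reduces to the two factors.\<close>
    have "(\<lambda>w. Z2 B (P w) $$ (i div m, j div m) * Z1 A G (S w) $$ (i mod m, j mod m)) \<in> borel_measurable M"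
      by (intro borel_measurable_times oproj_random_measurable[OF sym_pos_def_one Bt P Q2]
          oproj_random_measurable[OF G A S Q1] ij')
    moreover have "Z w $$ (i,j) = Z2 B (P w) $$ (i div m, j div m) * Z1 A G (S w) $$ (i mod m, j mod m)"
      if "w \<in> space M" for w
    proof -
      have "Z2 B (P w) \<in> carrier_mat n n" "Z1 A G (S w) \<in> carrier_mat m m"
        using Q1[OF that] Q2[OF that] A B by (auto simp: oproj_def)
      then show ?thesis using ij by (simp add: Z_def index_kron)
    qed
    ultimately show ?thesis by (simp cong: measurable_cong)
  qed
  have "n * m > 0" using \<open>m > 0\<close> \<open>n > 0\<close> by simp
  \<comment> \<open>The general bounds are applied in dimension \<open>n * m\<close>, with the inner
    product given by \<open>kron (1\<^sub>m n) G\<close>.\<close>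
  from expect_mat_oproj[where Y = Y, OF sym_pos_def_kron_one[OF G] this Y Z meas]
  have 1: "expectation (\<lambda>w. real (mat_rank (Y w))) \<le> real n * real m"
    "0 \<le> lambda_min (expect_mat M (n * m) (n * m) Z)"
    "real n * real m * lambda_min (expect_mat M (n * m) (n * m) Z) \<le> expectation (\<lambda>w. real (mat_rank (Y w)))"
    by auto
  then have "0 \<le> 1 - expectation (\<lambda>w. real (mat_rank (Y w))) / (real m * real n)"
    "1 - expectation (\<lambda>w. real (mat_rank (Y w))) / (real m * real n) \<le> 1 - lambda_min (expect_mat M (n * m) (n * m) Z)"
    using \<open>m > 0\<close> \<open>n > 0\<close> by (simp_all add: divide_le_eq le_divide_eq mult.commute mult.left_commute)
  then show ?thesis using 1(2) by (simp add: Let_def Y_def[abs_def] Z_def[abs_def])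
qed

end
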